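(* For linear expectations $h,h'\in\mathsf{LinExp}$ it is decidable whether $h\preceq h'$, i.e., whether $h(\sigma)\le h'(\sigma)$ for all states $\sigma$.
   Context: Program variables form a finite set $\mathsf{Vars}$; a state is a map $\sigma\colon\mathsf{Vars}\to\mathbb{N}$. Linear expressions: $e::= r\mid x\mid r\cdot e\mid e+e\mid e\mathbin{\dot-}e$ with $r\in\mathbb{Q}_{\ge0}$, $x\in\mathsf{Vars}$, where $\dot-$ is subtraction truncated at $0$. Extended linear expressions: $\tilde e::= e\mid\infty$. Linear guards: $\varphi::= e<e\mid\varphi\wedge\varphi\mid\neg\varphi$ (with $e$ linear expressions, no $\infty$). Linear expectations $\mathsf{LinExp}$: $h::=\tilde e\mid[\varphi]\cdot h\mid h+h$, evaluated on states pointwise (values in $\mathbb{R}_{\ge0}\cup\{\infty\}$) with $[\varphi](\sigma)\in\{0,1\}$ the truth value of $\varphi$, $0\cdot\infty=0$ and $a+\infty=\infty$. *)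

theory Defs
  imports "HOL-Library.Extended_Nonnegative_Real" "HOL-Library.Nat_Bijection"
begin

text \<open>States are functions of type \<open>'v \<Rightarrow> nat\<close>. Finiteness of the type \<open>'v\<close>
  of program variables is only assumed where it is needed.\<close>

typedef nnrat = "{r :: rat. 0 \<le> r}"
  morphisms rat_of_nnrat nnrat_of_rat
  by auto

datatype 'v lexpr =
    Const nnrat
  | Var 'v
  | Scale nnrat "'v lexpr"
  | Plus "'v lexpr" "'v lexpr"
  | Monus "'v lexpr" "'v lexpr"

datatype 'v ext_lexpr = Finite "'v lexpr" | Infinity

datatype 'v guard =
    Less "'v lexpr" "'v lexpr"
  | Conj "'v guard" "'v guard"
  | Neg "'v guard"

datatype 'v linexp =
    Base "'v ext_lexpr"
  | Guarded "'v guard" "'v linexp"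
  | Add "'v linexp" "'v linexp"

primrec lexpr_val :: "'v lexpr \<Rightarrow> ('v \<Rightarrow> nat) \<Rightarrow> real" where
  "lexpr_val (Const r) \<sigma> = of_rat (rat_of_nnrat r)"
| "lexpr_val (Var x) \<sigma> = real (\<sigma> x)"
| "lexpr_val (Scale r e) \<sigma> = of_rat (rat_of_nnrat r) * lexpr_val e \<sigma>"
| "lexpr_val (Plus e e') \<sigma> = lexpr_val e \<sigma> + lexpr_val e' \<sigma>"
| "lexpr_val (Monus e e') \<sigma> = max 0 (lexpr_val e \<sigma> - lexpr_val e' \<sigma>)"

text \<open>\<^const>\<open>ennreal\<close> maps negative reals to 0; this is harmless here.\<close>

lemma lexpr_val_nonneg: "0 \<le> lexpr_val e \<sigma>"
  using rat_of_nnrat by (induction e) auto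

primrec ext_lexpr_val :: "'v ext_lexpr \<Rightarrow> ('v \<Rightarrow> nat) \<Rightarrow> ennreal" where
  "ext_lexpr_val (Finite e) \<sigma> = ennreal (lexpr_val e \<sigma>)"
| "ext_lexpr_val Infinity \<sigma> = \<infinity>"

primrec guard_val :: "'v guard \<Rightarrow> ('v \<Rightarrow> nat) \<Rightarrow> bool" where
  "guard_val (Less e e') \<sigma> \<longleftrightarrow> lexpr_val e \<sigma> < lexpr_val e' \<sigma>"
| "guard_val (Conj \<phi> \<psi>) \<sigma> \<longleftrightarrow> guard_val \<phi> \<sigma> \<and> guard_val \<psi> \<sigma>"
| "guard_val (Neg \<phi>) \<sigma> \<longleftrightarrow> \<not> guard_val \<phi> \<sigma>"

text \<open>In \<^typ>\<open>ennreal\<close>, \<open>0 * \<infinity> = 0\<close> and \<open>a + \<infinity> = \<infinity>\<close>.\<close>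

primrec linexp_val :: "'v linexp \<Rightarrow> ('v \<Rightarrow> nat) \<Rightarrow> ennreal" where
  "linexp_val (Base t) \<sigma> = ext_lexpr_val t \<sigma>"
| "linexp_val (Guarded \<phi> h) \<sigma> = of_bool (guard_val \<phi> \<sigma>) * linexp_val h \<sigma>"
| "linexp_val (Add h h') \<sigma> = linexp_val h \<sigma> + linexp_val h' \<sigma>"

definition linexp_le :: "'v linexp \<Rightarrow> 'v linexp \<Rightarrow> bool" (infix "\<preceq>" 50) where
  "h \<preceq> h' \<longleftrightarrow> (\<forall>\<sigma>. linexp_val h \<sigma> \<le> linexp_val h' \<sigma>)"


datatype recf =
    Zero
  | Succ
  | Proj nat
  | Comp recf "recf list"
  | PrimRec recf recf
  | Mu recf

text \<open>\<open>recf_eval f xs y\<close>: the function denoted by \<open>f\<close> is defined at \<open>xs\<close> and has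
  value \<open>y\<close>. The recursion and minimisation argument comes first.\<close>

inductive recf_eval :: "recf \<Rightarrow> nat list \<Rightarrow> nat \<Rightarrow> bool" where
  Zero: "recf_eval Zero xs 0"
| Succ: "recf_eval Succ [x] (Suc x)"
| Proj: "i < length xs \<Longrightarrow> recf_eval (Proj i) xs (xs ! i)"
| Comp: "list_all2 (\<lambda>g y. recf_eval g xs y) gs ys \<Longrightarrow> recf_eval f ys z
    \<Longrightarrow> recf_eval (Comp f gs) xs z"
| PrimRec_0: "recf_eval f xs y \<Longrightarrow> recf_eval (PrimRec f g) (0 # xs) y"
| PrimRec_Suc: "recf_eval (PrimRec f g) (n # xs) y \<Longrightarrow> recf_eval g (n # y # xs) z
    \<Longrightarrow> recf_eval (PrimRec f g) (Suc n # xs) z"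
| Mu: "recf_eval f (n # xs) 0 \<Longrightarrow> (\<And>m. m < n \<Longrightarrow> \<exists>y. recf_eval f (m # xs) (Suc y))
    \<Longrightarrow> recf_eval (Mu f) xs n"

lemma recf_eval_deterministic:
  "recf_eval f xs y \<Longrightarrow> recf_eval f xs z \<Longrightarrow> y = z"
proof (induction arbitrary: z rule: recf_eval.induct)
  case (Zero xs)
  then show ?case by (cases rule: recf_eval.cases) simp
next
  case (Succ x)
  then show ?case by (cases rule: recf_eval.cases) simp
next
  case (Proj i xs)
  from Proj.prems show ?case by (cases rule: recf_eval.cases) simp
next
  case (Comp xs gs ys f w)
  from Comp.prems obtain ys' where ys': "list_all2 (\<lambda>g y. recf_eval g xs y) gs ys'"
    and z: "recf_eval f ys' z"
    by (cases rule: recf_eval.cases) simp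
  have "ys = ys'"
    using Comp.IH(1) ys' by (auto simp: list_all2_conv_all_nth intro!: nth_equalityI)
  with z Comp.IH(2) show ?case by simp
next
  case (PrimRec_0 f xs y g)
  from PrimRec_0.prems have "recf_eval f xs z" by (cases rule: recf_eval.cases) simp
  then show ?case by (rule PrimRec_0.IH)
next
  case (PrimRec_Suc f g n xs y w)
  from PrimRec_Suc.prems obtain y'
    where y': "recf_eval (PrimRec f g) (n # xs) y'" and z: "recf_eval g (n # y' # xs) z"
    by (cases rule: recf_eval.cases) simp
  from PrimRec_Suc.IH(1)[OF y'] z PrimRec_Suc.IH(2) show ?case by simp
next
  case (Mu f n xs)
  from Mu.prems have 0: "recf_eval f (z # xs) 0"
    and less: "\<And>m. m < z \<Longrightarrow> \<exists>y. recf_eval f (m # xs) (Suc y)"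
    by (cases rule: recf_eval.cases, simp)+
  have "\<not> n < z" using less Mu.IH(1) by blast
  moreover have "\<not> z < n" using Mu.IH(2) 0 by blast
  ultimately show ?case by simp
qed

text \<open>The decider has to terminate on all inputs, also on those that encode nothing.\<close>

definition decidable2 :: "('a \<Rightarrow> nat) \<Rightarrow> ('b \<Rightarrow> nat) \<Rightarrow> ('a \<Rightarrow> 'b \<Rightarrow> bool) \<Rightarrow> bool" where
  "decidable2 enc enc' R \<longleftrightarrow>
     (\<exists>f. (\<forall>m n. \<exists>y. recf_eval f [m, n] y) \<and>
          (\<forall>a b. recf_eval f [enc a, enc' b] (if R a b then 1 else 0)))"


text \<open>The numbering is relative to a numbering \<open>c\<close> of the program variables. As there are only
  finitely many variables, any two injective choices of \<open>c\<close> are computably equivalent.\<close>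

definition nnrat_code :: "nnrat \<Rightarrow> nat" where
  "nnrat_code r = (case quotient_of (rat_of_nnrat r) of (p, q) \<Rightarrow> prod_encode (nat p, nat q))"

primrec lexpr_code :: "('v \<Rightarrow> nat) \<Rightarrow> 'v lexpr \<Rightarrow> nat" where
  "lexpr_code c (Const r) = prod_encode (0, nnrat_code r)"
| "lexpr_code c (Var x) = prod_encode (1, c x)"
| "lexpr_code c (Scale r e) = prod_encode (2, prod_encode (nnrat_code r, lexpr_code c e))"
| "lexpr_code c (Plus e e') = prod_encode (3, prod_encode (lexpr_code c e, lexpr_code c e'))"
| "lexpr_code c (Monus e e') = prod_encode (4, prod_encode (lexpr_code c e, lexpr_code c e'))"

primrec ext_lexpr_code :: "('v \<Rightarrow> nat) \<Rightarrow> 'v ext_lexpr \<Rightarrow> nat" where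
  "ext_lexpr_code c (Finite e) = Suc (lexpr_code c e)"
| "ext_lexpr_code c Infinity = 0"

primrec guard_code :: "('v \<Rightarrow> nat) \<Rightarrow> 'v guard \<Rightarrow> nat" where
  "guard_code c (Less e e') = prod_encode (0, prod_encode (lexpr_code c e, lexpr_code c e'))"
| "guard_code c (Conj \<phi> \<psi>) = prod_encode (1, prod_encode (guard_code c \<phi>, guard_code c \<psi>))"
| "guard_code c (Neg \<phi>) = prod_encode (2, guard_code c \<phi>)"

primrec linexp_code :: "('v \<Rightarrow> nat) \<Rightarrow> 'v linexp \<Rightarrow> nat" where
  "linexp_code c (Base t) = prod_encode (0, ext_lexpr_code c t)"
| "linexp_code c (Guarded \<phi> h) = prod_encode (1, prod_encode (guard_code c \<phi>, linexp_code c h))"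
| "linexp_code c (Add h h') = prod_encode (2, prod_encode (linexp_code c h, linexp_code c h'))"

lemma nnrat_code_inject: "nnrat_code r = nnrat_code s \<Longrightarrow> r = s"
proof -
  assume eq: "nnrat_code r = nnrat_code s"
  obtain p q where r: "quotient_of (rat_of_nnrat r) = (p, q)" by fastforce
  obtain p' q' where s: "quotient_of (rat_of_nnrat s) = (p', q')" by fastforce
  have pos: "q > 0" "q' > 0" using r s quotient_of_denom_pos by auto
  have "rat_of_nnrat r \<ge> 0" "rat_of_nnrat s \<ge> 0" using rat_of_nnrat by auto
  then have nonneg: "p \<ge> 0" "p' \<ge> 0"
    using quotient_of_div[OF r] quotient_of_div[OF s] pos by (auto simp: zero_le_divide_iff)
  have "nat p = nat p'" "nat q = nat q'"
    using eq r s by (simp_all add: nnrat_code_def)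
  with nonneg pos have "quotient_of (rat_of_nnrat r) = quotient_of (rat_of_nnrat s)"
    using r s by (simp add: eq_nat_nat_iff)
  then show "r = s"
    by (simp add: quotient_of_inject_eq rat_of_nnrat_inject)
qed

lemma lexpr_code_inject: "inj c \<Longrightarrow> lexpr_code c e = lexpr_code c e' \<Longrightarrow> e = e'"
  by (induction e arbitrary: e'; case_tac e') (auto dest: nnrat_code_inject injD)

lemma ext_lexpr_code_inject: "inj c \<Longrightarrow> ext_lexpr_code c t = ext_lexpr_code c t' \<Longrightarrow> t = t'"
  by (cases t; cases t') (auto dest: lexpr_code_inject)

lemma guard_code_inject: "inj c \<Longrightarrow> guard_code c \<phi> = guard_code c \<psi> \<Longrightarrow> \<phi> = \<psi>"
  by (induction \<phi> arbitrary: \<psi>; case_tac \<psi>) (auto dest: lexpr_code_inject)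

lemma inj_linexp_code: "inj c \<Longrightarrow> inj (linexp_code c)"
proof (rule injI)
  show "h = h'" if "inj c" "linexp_code c h = linexp_code c h'" for h h'
    using that
  proof (induction h arbitrary: h')
    case (Base t)
    then show ?case by (cases h') (auto dest: ext_lexpr_code_inject)
  next
    case (Guarded \<phi> h)
    then show ?case by (cases h') (auto dest: guard_code_inject)
  next
    case (Add h1 h2)
    then show ?case by (cases h') auto
  qed
qed

end

theory Submission imports Defs begin

text \<open>The proof combines a small model property with bounded search. Whether \<open>h \<preceq> h'\<close> fails at a
  state only depends on the signs, at that state, of finitely many affine functions with integer
  coefficients bounded by \<open>2 ^ (m + n + 2)\<close>, where \<open>m\<close> and \<open>n\<close> are the codes of \<open>h\<close> and \<open>h'\<close>.
  By eliminating one variable after the other as in Cooper's algorithm, every state is found to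
  have the same signs as a state whose size is at most exponential in \<open>m + n\<close>. So it suffices
  to compare \<open>h\<close> and \<open>h'\<close> on boundedly many states, and the values there are computed from the
  codes by course-of-values recursion.\<close>

section \<open>Closure properties of the computable functions\<close>

text \<open>The obstacle is that monus and guards nest, so an expression is only piecewise affine.
  No normal form is computed. Instead two states are compared: if \<sigma> and \<tau> show the same
  signs, the same pieces are active at both, so a single affine function over a single denominator
  yields both values (\<open>linear_pair\<close>). Elimination of variables then occurs only in an
  existence proof, and the program merely evaluates both sides on finitely many states. This is
  primitive recursive, hence total also on numbers that code nothing. The bounds are read off the
  codes. A code with positive tag exceeds the sum of its two component codes, so
  \<open>2 ^ code\<close> bounds the integer coefficients and denominators of a value; the factor 4
  in \<open>2 ^ (m + n + 2)\<close> pays for comparing two such fractions. Elimination over the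
  reals would not do, because a state has natural values; this is why residue classes are carried
  along. The number of variables is fixed, so the exponent \<open>small_exp\<close> is a constant of
  the program.\<close>

definition computable :: "nat \<Rightarrow> (nat list \<Rightarrow> nat) \<Rightarrow> bool" where
  "computable k f \<longleftrightarrow> (\<exists>p. \<forall>xs. length xs = k \<longrightarrow> recf_eval p xs (f xs))"

lemma computable_cong:
  assumes "computable k f" "\<And>xs. length xs = k \<Longrightarrow> f xs = g xs"
  shows "computable k g"
  using assms unfolding computable_def by metis

lemma computable_nth: "i < k \<Longrightarrow> computable k (\<lambda>xs. xs ! i)"
  unfolding computable_def by (intro exI[of _ "Proj i"]) (auto intro: recf_eval.Proj)

lemma computable_compose:
  assumes "computable (length gs) f" "\<And>g. g \<in> set gs \<Longrightarrow> computable k g"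
  shows "computable k (\<lambda>xs. f (map (\<lambda>g. g xs) gs))"
proof -
  obtain p where p: "\<And>xs. length xs = length gs \<Longrightarrow> recf_eval p xs (f xs)"
    using assms(1) unfolding computable_def by auto
  have "\<forall>g\<in>set gs. \<exists>q. \<forall>xs. length xs = k \<longrightarrow> recf_eval q xs (g xs)"
    using assms(2) unfolding computable_def by auto
  then obtain q where q: "\<And>g xs. g \<in> set gs \<Longrightarrow> length xs = k \<Longrightarrow> recf_eval (q g) xs (g xs)"
    by metis
  have "recf_eval (Comp p (map q gs)) xs (f (map (\<lambda>g. g xs) gs))" if "length xs = k" for xs
    by (rule recf_eval.Comp[where ys = "map (\<lambda>g. g xs) gs"])
      (use p q that in \<open>auto simp: list_all2_conv_all_nth\<close>)
  then show ?thesis unfolding computable_def by blast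
qed

lemma computable_compose1:
  assumes "computable 1 (\<lambda>xs. F (xs ! 0))" "computable k a"
  shows "computable k (\<lambda>xs. F (a xs))"
  using computable_compose[of "[a]" "\<lambda>xs. F (xs ! 0)" k] assms by simp

lemma computable_compose2:
  assumes "computable 2 (\<lambda>xs. F (xs ! 0) (xs ! 1))" "computable k a" "computable k b"
  shows "computable k (\<lambda>xs. F (a xs) (b xs))"
  using computable_compose[of "[a, b]" "\<lambda>xs. F (xs ! 0) (xs ! 1)" k] assms
  by (auto simp: numeral_eq_Suc)

lemma computable_compose3:
  assumes "computable 3 (\<lambda>xs. F (xs ! 0) (xs ! 1) (xs ! 2))"
    "computable k a" "computable k b" "computable k d"
  shows "computable k (\<lambda>xs. F (a xs) (b xs) (d xs))"
  using computable_compose[of "[a, b, d]" "\<lambda>xs. F (xs ! 0) (xs ! 1) (xs ! 2)" k] assms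
  by (auto simp: numeral_eq_Suc)

lemma computable_primrec:
  assumes "computable k b" "computable (Suc (Suc k)) s"
    and "\<And>xs. length xs = k \<Longrightarrow> F 0 xs = b xs"
    and "\<And>n xs. length xs = k \<Longrightarrow> F (Suc n) xs = s (n # F n xs # xs)"
  shows "computable (Suc k) (\<lambda>xs. F (xs ! 0) (tl xs))"
proof -
  obtain p where p: "\<And>xs. length xs = k \<Longrightarrow> recf_eval p xs (b xs)"
    using assms(1) unfolding computable_def by auto
  obtain q where q: "\<And>xs. length xs = Suc (Suc k) \<Longrightarrow> recf_eval q xs (s xs)"
    using assms(2) unfolding computable_def by auto
  have *: "recf_eval (PrimRec p q) (n # xs) (F n xs)" if "length xs = k" for n xs
  proof (induction n)
    case 0
    then show ?case using p assms(3) that by (auto intro: recf_eval.PrimRec_0)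
  next
    case (Suc n)
    have "recf_eval q (n # F n xs # xs) (F (Suc n) xs)"
      using q[of "n # F n xs # xs"] assms(4) that by simp
    with Suc show ?case by (rule recf_eval.PrimRec_Suc)
  qed
  have "recf_eval (PrimRec p q) xs (F (xs ! 0) (tl xs))" if "length xs = Suc k" for xs
    using that *[of "tl xs" "xs ! 0"] by (cases xs) auto
  then show ?thesis unfolding computable_def by blast
qed

lemma computable_primrec0:
  assumes "F 0 = b" "\<And>n. F (Suc n) = s n (F n)" "computable 0 (\<lambda>xs. b)"
    and "computable 2 (\<lambda>xs. s (xs ! 0) (xs ! 1))"
  shows "computable 1 (\<lambda>xs. F (xs ! 0))"
  using computable_primrec[of 0 "\<lambda>xs. b" "\<lambda>xs. s (xs ! 0) (xs ! 1)" "\<lambda>n xs. F n"] assms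
  by (auto simp: numeral_eq_Suc elim!: computable_cong)

lemma computable_primrec1:
  assumes "\<And>x. F 0 x = b x" "\<And>n x. F (Suc n) x = s n (F n x) x"
    and "computable 1 (\<lambda>xs. b (xs ! 0))"
    and "computable 3 (\<lambda>xs. s (xs ! 0) (xs ! 1) (xs ! 2))"
  shows "computable 2 (\<lambda>xs. F (xs ! 0) (xs ! 1))"
proof -
  have "computable (Suc 1) (\<lambda>xs. F (xs ! 0) (tl xs ! 0))"
    by (rule computable_primrec[where b = "\<lambda>xs. b (xs ! 0)"
          and s = "\<lambda>xs. s (xs ! 0) (xs ! 1) (xs ! 2)"])
      (use assms in \<open>auto simp: numeral_eq_Suc\<close>)
  then have "computable 2 (\<lambda>xs. F (xs ! 0) (tl xs ! 0))"
    by (simp add: numeral_eq_Suc)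
  then show ?thesis
    by (rule computable_cong) (auto simp: nth_tl numeral_eq_Suc)
qed

lemma computable_primrec2:
  assumes "\<And>x y. F 0 x y = b x y" "\<And>n x y. F (Suc n) x y = s n (F n x y) x y"
    and "computable 2 (\<lambda>xs. b (xs ! 0) (xs ! 1))"
    and "computable 4 (\<lambda>xs. s (xs ! 0) (xs ! 1) (xs ! 2) (xs ! 3))"
  shows "computable 3 (\<lambda>xs. F (xs ! 0) (xs ! 1) (xs ! 2))"
proof -
  have "computable (Suc 2) (\<lambda>xs. F (xs ! 0) (tl xs ! 0) (tl xs ! 1))"
    by (rule computable_primrec[where b = "\<lambda>xs. b (xs ! 0) (xs ! 1)"
          and s = "\<lambda>xs. s (xs ! 0) (xs ! 1) (xs ! 2) (xs ! 3)"])
      (use assms in \<open>auto simp: numeral_eq_Suc\<close>)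
  then have "computable 3 (\<lambda>xs. F (xs ! 0) (tl xs ! 0) (tl xs ! 1))"
    by (simp add: numeral_eq_Suc)
  then show ?thesis
    by (rule computable_cong) (auto simp: nth_tl numeral_eq_Suc)
qed

lemma computable_Suc: "computable k a \<Longrightarrow> computable k (\<lambda>xs. Suc (a xs))"
proof (erule computable_compose1[rotated])
  have "recf_eval Succ xs (Suc (xs ! 0))" if "length xs = 1" for xs
    using that recf_eval.Succ by (cases xs) auto
  then show "computable 1 (\<lambda>xs. Suc (xs ! 0))"
    unfolding computable_def by blast
qed

lemma computable_const: "computable k (\<lambda>xs. a)"
proof (induction a)
  case 0
  show ?case unfolding computable_def by (auto intro: recf_eval.Zero)
qed (rule computable_Suc)

named_theorems comp_intros

lemmas [comp_intros] = computable_nth computable_const computable_Suc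

lemma computable_add [comp_intros]:
  "computable k a \<Longrightarrow> computable k b \<Longrightarrow> computable k (\<lambda>xs. a xs + b xs)"
  by (erule (1) computable_compose2[rotated],
      rule computable_primrec1[where b = "\<lambda>x. x" and s = "\<lambda>n y x. Suc y"])
    (auto intro!: comp_intros)

lemma computable_pred: "computable k a \<Longrightarrow> computable k (\<lambda>xs. a xs - 1)"
  by (erule computable_compose1[rotated, where F = "\<lambda>x. x - 1"],
      rule computable_primrec0[where b = 0 and s = "\<lambda>n y. n"])
    (auto intro!: comp_intros)

lemma computable_diff [comp_intros]:
  assumes "computable k a" "computable k b"
  shows "computable k (\<lambda>xs. a xs - b xs)"
proof (rule computable_compose2[OF _ assms(2,1)])
  show "computable 2 (\<lambda>xs. xs ! 1 - xs ! 0)"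
    by (rule computable_primrec1[where F = "\<lambda>n x. x - n" and b = "\<lambda>x. x" and s = "\<lambda>n y x. y - 1"])
      (auto intro!: comp_intros computable_pred[simplified])
qed

lemma computable_mult [comp_intros]:
  "computable k a \<Longrightarrow> computable k b \<Longrightarrow> computable k (\<lambda>xs. a xs * b xs)"
  by (erule (1) computable_compose2[rotated],
      rule computable_primrec1[where b = "\<lambda>x. 0" and s = "\<lambda>n y x. x + y"])
    (auto intro!: comp_intros)

lemma computable_pow2 [comp_intros]:
  "computable k a \<Longrightarrow> computable k (\<lambda>xs. 2 ^ a xs)"
  by (erule computable_compose1[rotated],
      rule computable_primrec0[where b = 1 and s = "\<lambda>n y. y + y"])
    (auto intro!: comp_intros)

lemma computable_not [comp_intros]:
  assumes "computable k (\<lambda>xs. of_bool (P xs))"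
  shows "computable k (\<lambda>xs. of_bool (\<not> P xs))"
proof -
  have "computable k (\<lambda>xs. 1 - of_bool (P xs))" by (intro comp_intros assms)
  then show ?thesis by (rule computable_cong) auto
qed

lemma computable_conj [comp_intros]:
  assumes "computable k (\<lambda>xs. of_bool (P xs))" "computable k (\<lambda>xs. of_bool (Q xs))"
  shows "computable k (\<lambda>xs. of_bool (P xs \<and> Q xs))"
proof -
  have "computable k (\<lambda>xs. of_bool (P xs) * of_bool (Q xs))" by (intro comp_intros assms)
  then show ?thesis by (rule computable_cong) auto
qed

lemma computable_disj [comp_intros]:
  assumes "computable k (\<lambda>xs. of_bool (P xs))" "computable k (\<lambda>xs. of_bool (Q xs))"
  shows "computable k (\<lambda>xs. of_bool (P xs \<or> Q xs))"
proof -
  have "computable k (\<lambda>xs. of_bool (\<not> (\<not> P xs \<and> \<not> Q xs)))" by (intro comp_intros assms)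
  then show ?thesis by simp
qed

lemma computable_if [comp_intros]:
  assumes "computable k (\<lambda>xs. of_bool (P xs))" "computable k a" "computable k b"
  shows "computable k (\<lambda>xs. if P xs then a xs else b xs)"
proof -
  have "computable k (\<lambda>xs. of_bool (P xs) * a xs + of_bool (\<not> P xs) * b xs)"
    by (intro comp_intros assms)
  then show ?thesis by (rule computable_cong) auto
qed

lemma computable_le [comp_intros]:
  assumes "computable k a" "computable k b"
  shows "computable k (\<lambda>xs. of_bool (a xs \<le> b xs))"
proof -
  have "computable k (\<lambda>xs. 1 - (a xs - b xs))" by (intro comp_intros assms)
  then show ?thesis by (rule computable_cong) auto
qed

lemma computable_less [comp_intros]:
  assumes "computable k a" "computable k b"
  shows "computable k (\<lambda>xs. of_bool (a xs < b xs))"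
  using computable_not[OF computable_le[OF assms(2,1)]] by (simp add: not_le)

lemma computable_eq [comp_intros]:
  assumes "computable k a" "computable k b"
  shows "computable k (\<lambda>xs. of_bool (a xs = b xs))"
  using computable_conj[OF computable_le[OF assms] computable_le[OF assms(2,1)]]
  by (simp add: eq_iff)

text \<open>Bounded search is primitive recursion on the bound, the truth value being a running
  product. The two parameters will be the codes of the two expectations.\<close>

lemma computable_all_less:
  assumes "computable 3 (\<lambda>xs. of_bool (P (xs ! 0) (xs ! 1) (xs ! 2)))"
    and "computable k a" "computable k b" "computable k d"
  shows "computable k (\<lambda>xs. of_bool (\<forall>i<a xs. P i (b xs) (d xs)))"
proof (rule computable_compose3[OF _ assms(2-4)])
  \<comment> \<open>Index 1 is skipped: there the step function of the recursion receives the
    accumulator.\<close>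
  have *: "computable 4 (\<lambda>xs. of_bool (P (xs ! 0) (xs ! 2) (xs ! 3)))"
    by (rule computable_compose3[OF assms(1)]) (auto intro!: comp_intros)
  show "computable 3 (\<lambda>xs. of_bool (\<forall>i<xs ! 0. P i (xs ! 1) (xs ! 2)))"
    by (rule computable_primrec2[where F = "\<lambda>n x y. of_bool (\<forall>i<n. P i x y)"
          and b = "\<lambda>x y. 1" and s = "\<lambda>n z x y. z * of_bool (P n x y)"])
      (auto simp: less_Suc_eq intro!: comp_intros *)
qed

section \<open>Cantor pairing and its inverse\<close>

lemma computable_triangle [comp_intros]:
  "computable k a \<Longrightarrow> computable k (\<lambda>xs. triangle (a xs))"
  by (erule computable_compose1[rotated],
      rule computable_primrec0[where b = 0 and s = "\<lambda>n y. y + Suc n"])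
    (auto intro!: comp_intros)

lemma computable_prod_encode [comp_intros]:
  assumes "computable k a" "computable k b"
  shows "computable k (\<lambda>xs. prod_encode (a xs, b xs))"
  unfolding prod_encode_def by (simp, intro comp_intros assms)

abbreviation pfst :: "nat \<Rightarrow> nat" where "pfst n \<equiv> fst (prod_decode n)"
abbreviation psnd :: "nat \<Rightarrow> nat" where "psnd n \<equiv> snd (prod_decode n)"

lemma triangle_diagonal: "triangle (pfst n + psnd n) + pfst n = n"
  using prod_decode_inverse[of n] unfolding prod_encode_def by (simp add: case_prod_beta)

text \<open>The enumeration walks along the diagonals of constant sum; when the second component is
  used up, it starts the next diagonal.\<close>

lemma prod_decode_Suc:
  "prod_decode (Suc n) =
     (if psnd n = 0 then (0, Suc (pfst n)) else (Suc (pfst n), psnd n - 1))"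
proof -
  obtain x y where xy: "prod_decode n = (x, y)" by fastforce
  then have n: "n = prod_encode (x, y)" by (metis prod_decode_inverse)
  have "Suc n = prod_encode (if y = 0 then (0, Suc x) else (Suc x, y - 1))"
    unfolding n prod_encode_def by (cases y) auto
  then show ?thesis using xy by (simp add: prod_encode_inverse)
qed

text \<open>The number of the diagonal suffices to invert the pairing, since \<open>pfst n\<close>
  is the distance of \<open>n\<close> from the last triangular number. It grows exactly when
  \<open>Suc n\<close> is the next triangular number, which is a primitive recursion.\<close>

lemma computable_diagonal: "computable 1 (\<lambda>xs. pfst (xs ! 0) + psnd (xs ! 0))"
proof (rule computable_primrec0[where F = "\<lambda>n. pfst n + psnd n" and b = 0
      and s = "\<lambda>n d. if triangle (Suc d) = Suc n then Suc d else d"])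
  show "pfst 0 + psnd 0 = 0"
    by (simp add: prod_decode_def prod_decode_aux.simps)
  fix n
  obtain x y where xy: "prod_decode n = (x, y)" by fastforce
  then have n: "n = triangle (x + y) + x" using triangle_diagonal[of n] by simp
  show "pfst (Suc n) + psnd (Suc n) =
      (if triangle (Suc (pfst n + psnd n)) = Suc n then Suc (pfst n + psnd n) else pfst n + psnd n)"
    using xy n by (auto simp: prod_decode_Suc)
qed (intro comp_intros; simp)+

lemma computable_pfst [comp_intros]:
  assumes "computable k a" shows "computable k (\<lambda>xs. pfst (a xs))"
proof -
  have eq: "n - triangle (pfst n + psnd n) = pfst n" for n
    using triangle_diagonal[of n] by linarith
  have "computable k (\<lambda>xs. a xs - triangle (pfst (a xs) + psnd (a xs)))"
    by (intro computable_diff computable_triangle assms computable_compose1[OF computable_diagonal])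
  then show ?thesis unfolding eq .
qed

lemma computable_psnd [comp_intros]:
  assumes "computable k a" shows "computable k (\<lambda>xs. psnd (a xs))"
proof -
  have "computable k (\<lambda>xs. (pfst (a xs) + psnd (a xs)) - pfst (a xs))"
    by (intro computable_diff computable_pfst assms computable_compose1[OF computable_diagonal])
  then show ?thesis by simp
qed

text \<open>Every number decodes to a sequence, so searching over states is searching over plain
  numbers and no well-formedness test is needed.\<close>

definition lookup :: "nat \<Rightarrow> nat \<Rightarrow> nat" where
  "lookup s i = pfst ((psnd ^^ i) s)"

lemma lookup_cons [simp]:
  "lookup (prod_encode (a, s)) 0 = a"
  "lookup (prod_encode (a, s)) (Suc i) = lookup s i"
  unfolding lookup_def by (simp_all add: funpow_Suc_right del: funpow.simps)

lemma computable_lookup [comp_intros]: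
  assumes "computable k a" "computable k b"
  shows "computable k (\<lambda>xs. lookup (a xs) (b xs))"
proof -
  have "computable 2 (\<lambda>xs. (psnd ^^ (xs ! 0)) (xs ! 1))"
    by (rule computable_primrec1[where F = "\<lambda>i s. (psnd ^^ i) s" and b = "\<lambda>x. x"
          and s = "\<lambda>n y x. psnd y"]) (auto intro!: comp_intros)
  from computable_compose2[OF this assms(2,1)] show ?thesis
    unfolding lookup_def by (rule computable_pfst)
qed

lemma prod_encode_mono: "a \<le> a' \<Longrightarrow> b \<le> b' \<Longrightarrow> prod_encode (a, b) \<le> prod_encode (a', b')"
proof -
  assume "a \<le> a'" "b \<le> b'"
  moreover have "mono triangle" by (rule incseq_SucI) simp
  ultimately show ?thesis
    unfolding prod_encode_def by (simp add: add_mono monoD)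
qed

text \<open>Pairing is monotone, so this constant list bounds the codes of all lists of length
  \<open>l\<close> with entries at most \<open>b\<close> and tail 0. The length is a fixed number;
  only \<open>b\<close> is an input.\<close>

primrec replicate_code :: "nat \<Rightarrow> nat \<Rightarrow> nat" where
  "replicate_code 0 b = 0"
| "replicate_code (Suc l) b = prod_encode (b, replicate_code l b)"

lemma computable_replicate_code [comp_intros]:
  "computable k b \<Longrightarrow> computable k (\<lambda>xs. replicate_code l (b xs))"
  by (induction l) (auto intro!: comp_intros)

lemma ex_lookup_eq:
  "(\<And>i. i < l \<Longrightarrow> w i \<le> b) \<Longrightarrow> \<exists>s\<le>replicate_code l b. \<forall>i<l. lookup s i = w i"
proof (induction l arbitrary: w)
  case (Suc l)
  obtain s where s: "s \<le> replicate_code l b" "\<forall>i<l. lookup s i = w (Suc i)"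
    using Suc.IH[of "\<lambda>i. w (Suc i)"] Suc.prems by (metis Suc_less_eq)
  show ?case
    using s Suc.prems[of 0]
    by (intro exI[of _ "prod_encode (w 0, s)"]) (auto simp: prod_encode_mono less_Suc_eq_0_disj)
qed auto

primrec history :: "(nat \<Rightarrow> nat \<Rightarrow> nat \<Rightarrow> nat) \<Rightarrow> nat \<Rightarrow> nat \<Rightarrow> nat" where
  "history g 0 s = 0"
| "history g (Suc n) s = prod_encode (g (history g n s) n s, history g n s)"

text \<open>Course-of-values recursion: \<open>g\<close> receives the code of the list of the earlier values,
  latest first.\<close>

definition cov_rec :: "(nat \<Rightarrow> nat \<Rightarrow> nat \<Rightarrow> nat) \<Rightarrow> nat \<Rightarrow> nat \<Rightarrow> nat" where
  "cov_rec g n s = g (history g n s) n s"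

lemma lookup_history: "i < n \<Longrightarrow> lookup (history g n s) (n - Suc i) = cov_rec g i s"
proof (induction n)
  case (Suc n)
  show ?case
  proof (cases "i = n")
    case False
    then have "Suc n - Suc i = Suc (n - Suc i)" using Suc.prems by simp
    then show ?thesis using Suc False by simp
  qed (simp add: cov_rec_def)
qed simp

lemma computable_cov_rec:
  assumes g: "computable 3 (\<lambda>xs. g (xs ! 0) (xs ! 1) (xs ! 2))"
    and "computable k a" "computable k b"
  shows "computable k (\<lambda>xs. cov_rec g (a xs) (b xs))"
proof -
  have h: "computable 2 (\<lambda>xs. history g (xs ! 0) (xs ! 1))"
    by (rule computable_primrec1[where b = "\<lambda>x. 0" and s = "\<lambda>n y x. prod_encode (g y n x, y)"])
      (auto intro!: comp_intros computable_compose3[OF g])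
  show ?thesis
    unfolding cov_rec_def
    by (intro computable_compose3[OF g] assms computable_compose2[OF h])
qed

section \<open>Small solutions of affine constraints\<close>

type_synonym 'v affine = "('v \<Rightarrow> int) \<times> int"

definition affine_val :: "'v::finite affine \<Rightarrow> ('v \<Rightarrow> nat) \<Rightarrow> int" where
  "affine_val f \<sigma> = (\<Sum>x\<in>UNIV. fst f x * int (\<sigma> x)) + snd f"

definition bounded_by :: "int \<Rightarrow> 'v affine \<Rightarrow> bool" where
  "bounded_by N f \<longleftrightarrow> (\<forall>x. \<bar>fst f x\<bar> \<le> N) \<and> \<bar>snd f\<bar> \<le> N"

lemma bounded_by_mono: "bounded_by M f \<Longrightarrow> M \<le> N \<Longrightarrow> bounded_by N f"
  unfolding bounded_by_def by (meson order_trans)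

lemma affine_val_split:
  "affine_val f \<sigma> = fst f v * int (\<sigma> v) + affine_val ((fst f)(v := 0), snd f) \<sigma>"
proof -
  have "(\<Sum>x\<in>UNIV - {v}. ((fst f)(v := 0)) x * int (\<sigma> x)) = (\<Sum>x\<in>UNIV - {v}. fst f x * int (\<sigma> x))"
    by (rule sum.cong) auto
  then show ?thesis
    unfolding affine_val_def
    by (subst (1 2) sum.remove[of _ v]) simp_all
qed

lemma affine_val_upd:
  "affine_val f (\<sigma>(v := t)) = fst f v * int t + affine_val ((fst f)(v := 0), snd f) \<sigma>"
proof -
  have "affine_val ((fst f)(v := 0), snd f) (\<sigma>(v := t)) = affine_val ((fst f)(v := 0), snd f) \<sigma>"
    unfolding affine_val_def by (auto intro: sum.cong)
  then show ?thesis by (subst affine_val_split[of _ _ v]) simp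
qed

text \<open>The offset \<open>r\<close> serves to substitute a number for a variable, to keep the
  slack of a constraint, and to turn \<open><\<close> into \<open>\<le>\<close> by subtracting
  1.\<close>

definition lincomb :: "int \<Rightarrow> 'v affine \<Rightarrow> int \<Rightarrow> 'v affine \<Rightarrow> int \<Rightarrow> 'v affine" where
  "lincomb p f q g r = (\<lambda>x. p * fst f x + q * fst g x, p * snd f + q * snd g + r)"

lemma fst_lincomb: "fst (lincomb p f q g r) x = p * fst f x + q * fst g x"
  by (simp add: lincomb_def)

lemma affine_val_lincomb:
  "affine_val (lincomb p f q g r) \<sigma> = p * affine_val f \<sigma> + q * affine_val g \<sigma> + r"
  unfolding affine_val_def lincomb_def by (simp add: sum.distrib sum_distrib_left algebra_simps)

lemma bounded_by_lincomb:
  assumes "bounded_by M f" "bounded_by N g" "\<bar>p\<bar> * M + \<bar>q\<bar> * N + \<bar>r\<bar> \<le> K"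
  shows "bounded_by K (lincomb p f q g r)"
proof -
  \<comment> \<open>To be used with \<open>r' = 0\<close> for the coefficients and with
    \<open>r' = r\<close> for the constant term.\<close>
  have *: "\<bar>p * a + q * b + r'\<bar> \<le> K"
    if "\<bar>a\<bar> \<le> M" "\<bar>b\<bar> \<le> N" "\<bar>r'\<bar> \<le> \<bar>r\<bar>" for a b r'
  proof -
    have "\<bar>p * a + q * b + r'\<bar> \<le> \<bar>p\<bar> * \<bar>a\<bar> + \<bar>q\<bar> * \<bar>b\<bar> + \<bar>r'\<bar>"
      by (metis (no_types, lifting) abs_mult abs_triangle_ineq add_right_mono order_trans)
    also have "\<dots> \<le> \<bar>p\<bar> * M + \<bar>q\<bar> * N + \<bar>r\<bar>"
      using that by (intro add_mono mult_left_mono) auto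
    finally show ?thesis using assms(3) by simp
  qed
  show ?thesis
    using assms(1,2) *[of _ _ 0] *[of "snd f" "snd g" r] unfolding bounded_by_def lincomb_def by simp
qed

text \<open>The restriction to nonzero coefficients matters: during the elimination only the
  variables still in \<open>V\<close> are under control.\<close>

lemma affine_val_dvd:
  assumes "\<And>x. fst f x \<noteq> 0 \<Longrightarrow> m dvd int (\<sigma> x) - int (\<tau> x)"
  shows "m dvd affine_val f \<sigma> - affine_val f \<tau>"
proof -
  have "affine_val f \<sigma> - affine_val f \<tau> = (\<Sum>x\<in>UNIV. fst f x * (int (\<sigma> x) - int (\<tau> x)))"
    unfolding affine_val_def by (simp add: sum_subtractf algebra_simps)
  also have "m dvd \<dots>"
    using assms by (intro dvd_sum) (metis dvd_mult dvd_mult2 dvd_0_right mult_eq_0_iff)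
  finally show ?thesis .
qed

lemma affine_val_bound:
  fixes f :: "'v::finite affine"
  assumes "bounded_by N f" "\<And>x. fst f x \<noteq> 0 \<Longrightarrow> int (\<sigma> x) \<le> B" "0 \<le> B"
  shows "\<bar>affine_val f \<sigma>\<bar> \<le> int (card (UNIV :: 'v set)) * (N * B) + N"
proof -
  have "\<bar>fst f x * int (\<sigma> x)\<bar> \<le> N * B" for x
  proof (cases "fst f x = 0")
    case False
    with assms show ?thesis
      unfolding bounded_by_def abs_mult by (intro mult_mono) (auto intro: order_trans[OF abs_ge_zero])
  next
    case True
    have "0 \<le> N" using assms(1) unfolding bounded_by_def by (meson abs_ge_zero order_trans)
    with True assms(3) show ?thesis by simp
  qed
  then have "\<bar>\<Sum>x\<in>UNIV. fst f x * int (\<sigma> x)\<bar> \<le> (\<Sum>x\<in>(UNIV::'v set). N * B)"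
    by (intro order_trans[OF sum_abs] sum_mono)
  then show ?thesis
    using assms(1) unfolding affine_val_def bounded_by_def by auto
qed

text \<open>Eliminating a variable raises the bound on the coefficients from \<open>N\<close> to \<open>N ^ 4\<close> and
  multiplies the bound on the solution by \<open>N ^ 4\<close>.\<close>

primrec small_exp :: "nat \<Rightarrow> nat" where
  "small_exp 0 = 0"
| "small_exp (Suc k) = 4 * small_exp k + 4"

text \<open>Cooper's elimination of the variable \<open>v\<close>: its value is decreased in steps of \<open>D\<close> as
  long as all constraints hold. In the end it is less than \<open>D\<close>, or some constraint \<open>f\<close> is
  almost tight, so that \<open>v\<close> is an affine function of the other variables up to the factor
  \<open>fst f v\<close>. The new solution for the other variables is taken from the same residue classes
  modulo \<open>fst f v * D\<close>, so that the division is exact.\<close>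

lemma small_model_aux:
  fixes C :: "'v::finite affine set" and \<sigma> :: "'v \<Rightarrow> nat"
  assumes "finite V" "2 \<le> N" "int (card (UNIV :: 'v set)) \<le> N" "1 \<le> D" "D \<le> N"
    and "\<And>f. f \<in> C \<Longrightarrow> bounded_by N f"
    and "\<And>f x. f \<in> C \<Longrightarrow> x \<notin> V \<Longrightarrow> fst f x = 0"
    and "\<And>f. f \<in> C \<Longrightarrow> 0 \<le> affine_val f \<sigma>"
  shows "\<exists>\<tau>. (\<forall>f\<in>C. 0 \<le> affine_val f \<tau>) \<and>
      (\<forall>x\<in>V. int (\<tau> x) \<le> N ^ small_exp (card V) \<and> D dvd int (\<tau> x) - int (\<sigma> x))"
  using assms
proof (induction V arbitrary: N D C \<sigma> rule: finite_induct)
  case empty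
  then show ?case by blast
next
  case (insert v V N D C \<sigma>)
  let ?B = "(N ^ 4) ^ small_exp (card V)"
  note C_bound = insert.prems(5) and C_supp = insert.prems(6)
  have N: "2 \<le> N" using insert.prems by simp
  have sq: "2 * 2 \<le> N * N" using N by (intro mult_mono) auto
  have "N * 1 \<le> N * N" using N by (intro mult_left_mono) auto
  then have N_le: "N \<le> N * N" by simp
  have cube: "2 * (N * N) \<le> N * N * N" using N by (simp add: mult_right_mono)
  have "2 * (N * N * N) \<le> N * (N * N * N)" using N by (intro mult_right_mono) auto
  then have four: "2 * (N * N * N) \<le> N ^ 4" by (simp add: numeral_eq_Suc algebra_simps)
  \<comment> \<open>The last inequality dictates the exponent 4. An eliminated constraint combines
    two constraints with factors up to \<open>N\<close>, giving \<open>2 * (N * N)\<close>, and an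
    offset up to \<open>N * N * N\<close>; for \<open>N = 2\<close> equality holds.\<close>
  have N4: "2 \<le> N ^ 4" "N \<le> N ^ 4" "N * N \<le> N ^ 4" "N + N * N \<le> N ^ 4"
    "N * N * N + 2 * (N * N) \<le> N ^ 4"
    using sq N_le cube four by linarith+
  have B1: "1 \<le> ?B" using N by (intro one_le_power) simp
  have small: "N ^ small_exp (card (insert v V)) = N ^ 4 * ?B"
    using insert.hyps by (simp add: power_add power_mult)
  have grow: "x \<le> N ^ 4 * ?B" if "x \<le> N ^ 4" for x
    using that B1 N4(1) mult_left_mono[of 1 ?B "N ^ 4"] by simp
  define good where "good t \<longleftrightarrow> D dvd int t - int (\<sigma> v) \<and> (\<forall>f\<in>C. 0 \<le> affine_val f (\<sigma>(v := t)))" for t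
  have "good (\<sigma> v)" unfolding good_def using insert.prems(7) by simp
  \<comment> \<open>The least admissible value stands for the end of the descent:
    \<open>t - D\<close> is either negative or violates a constraint.\<close>
  define t where "t = (LEAST t. good t)"
  have t: "good t" unfolding t_def by (rule LeastI) fact
  have least: "\<not> good s" if "s < t" for s using that not_less_Least unfolding t_def by blast
  define rest where "rest f = ((fst f)(v := 0), snd f)" for f :: "'v affine"
  have rest_bound: "bounded_by N (rest f)" if "f \<in> C" for f
    using C_bound[OF that] N unfolding bounded_by_def rest_def by auto
  have rest_supp: "fst (rest f) x = 0" if "f \<in> C" "x \<notin> V" for f x
    using C_supp[OF that(1)] that(2) unfolding rest_def by auto
  have coeff: "\<bar>fst f v\<bar> \<le> N" if "f \<in> C" for f
    using C_bound[OF that] unfolding bounded_by_def by simp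
  have val: "affine_val f (\<tau>(v := s)) = fst f v * int s + affine_val (rest f) \<tau>" for f \<tau> s
    unfolding rest_def by (rule affine_val_upd)
  have IH: "\<exists>\<tau>. (\<forall>f\<in>C'. 0 \<le> affine_val f \<tau>) \<and>
      (\<forall>x\<in>V. int (\<tau> x) \<le> ?B \<and> D' dvd int (\<tau> x) - int (\<sigma> x))"
    if "1 \<le> D'" "D' \<le> N ^ 4" "\<And>f. f \<in> C' \<Longrightarrow> bounded_by (N ^ 4) f"
      "\<And>f x. f \<in> C' \<Longrightarrow> x \<notin> V \<Longrightarrow> fst f x = 0" "\<And>f. f \<in> C' \<Longrightarrow> 0 \<le> affine_val f \<sigma>" for C' D'
    using N4 insert.prems(2) by (intro insert.IH that) auto
  have finish: ?case
    if "\<And>x. x \<in> V \<Longrightarrow> int (\<tau> x) \<le> ?B \<and> D dvd int (\<tau> x) - int (\<sigma> x)"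
      and "int s \<le> N ^ 4 * ?B" "D dvd int s - int (\<sigma> v)"
      and "\<And>f. f \<in> C \<Longrightarrow> 0 \<le> affine_val f (\<tau>(v := s))" for \<tau> s
  proof (intro exI[of _ "\<tau>(v := s)"] conjI ballI)
    fix x assume "x \<in> insert v V"
    moreover have "?B \<le> N ^ 4 * ?B" using B1 N4(1) mult_right_mono[of 1 "N ^ 4" ?B] by simp
    ultimately show "int ((\<tau>(v := s)) x) \<le> N ^ small_exp (card (insert v V))"
      "D dvd int ((\<tau>(v := s)) x) - int (\<sigma> x)"
      unfolding small using that(1)[of x] that(2,3) by (auto split: if_splits)
  qed (rule that(4))
  show ?case
  proof (cases "int t < D")
    case True
    \<comment> \<open>Here \<open>t < D \<le> N\<close> is already small, so \<open>v\<close> keeps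
      the value \<open>t\<close>, which is substituted as a number.\<close>
    define plug where "plug f = lincomb 1 (rest f) 0 (rest f) (fst f v * int t)" for f
    have plug: "affine_val (plug f) \<tau> = affine_val f (\<tau>(v := t))" for f \<tau>
      unfolding plug_def affine_val_lincomb val by simp
    have plug_bound: "bounded_by (N ^ 4) (plug f)" if "f \<in> C" for f
    proof -
      have "\<bar>fst f v * int t\<bar> \<le> N * N"
        unfolding abs_mult using coeff[OF that] True insert.prems(4) N by (intro mult_mono) auto
      then show ?thesis
        unfolding plug_def using N4 rest_bound[OF that] by (intro bounded_by_lincomb) auto
    qed
    have "\<exists>\<tau>. (\<forall>f\<in>plug ` C. 0 \<le> affine_val f \<tau>) \<and>
      (\<forall>x\<in>V. int (\<tau> x) \<le> ?B \<and> D dvd int (\<tau> x) - int (\<sigma> x))"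
    proof (rule IH)
      show "D \<le> N ^ 4" "1 \<le> D" using insert.prems(3,4) N4(2) by auto
      show "fst f x = 0" if "f \<in> plug ` C" "x \<notin> V" for f x
        using that rest_supp unfolding plug_def by (auto simp: fst_lincomb)
      show "0 \<le> affine_val f \<sigma>" if "f \<in> plug ` C" for f
        using that t unfolding good_def by (auto simp: plug)
    qed (use plug_bound in auto)
    then obtain \<tau> where \<tau>: "\<And>f. f \<in> C \<Longrightarrow> 0 \<le> affine_val f (\<tau>(v := t))"
      "\<And>x. x \<in> V \<Longrightarrow> int (\<tau> x) \<le> ?B \<and> D dvd int (\<tau> x) - int (\<sigma> x)"
      by (auto simp: plug)
    show ?thesis
    proof (rule finish[OF \<tau>(2)])
      show "int t \<le> N ^ 4 * ?B" using True insert.prems(4) N4(2) by (intro grow) simp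
    qed (use t \<tau>(1) in \<open>auto simp: good_def\<close>)
  next
    case False
    define s where "s = t - nat D"
    have s: "int s = int t - D" "s < t" using False insert.prems(3) unfolding s_def by auto
    have "D dvd int s - int (\<sigma> v)"
      using t unfolding good_def s(1) by (metis diff_right_commute dvd_diff dvd_refl)
    with least[OF s(2)] obtain f where f: "f \<in> C" "affine_val f (\<sigma>(v := s)) < 0"
      unfolding good_def by (auto simp: not_le)
    define a where "a = fst f v"
    \<comment> \<open>This is the slack of \<open>f\<close> at \<open>t\<close>. It is nonnegative,
      and lowering \<open>v\<close> by \<open>D\<close> makes it negative, hence
      \<open>0 \<le> r < a * D\<close>; in particular \<open>a\<close> is positive.\<close>
    define r where "r = affine_val f (\<sigma>(v := t))"
    have r0: "0 \<le> r" using t f(1) unfolding r_def good_def by blast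
    have "affine_val f (\<sigma>(v := s)) = r - a * D"
      unfolding r_def val s(1) a_def by (simp add: algebra_simps)
    with f(2) have r1: "r < a * D" by simp
    have a: "1 \<le> a" 
    proof (rule ccontr)
      assume "\<not> 1 \<le> a"
      then have "a * D \<le> 0" using insert.prems(3) by (intro mult_nonpos_nonneg) auto
      with r0 r1 show False by simp
    qed
    have aN: "a \<le> N" using coeff[OF f(1)] unfolding a_def by simp
    have aD: "a * D \<le> N * N" using a aN insert.prems(3,4) by (intro mult_mono) auto
    have a_t: "a * int t = r - affine_val (rest f) \<sigma>" unfolding r_def val a_def by simp
    \<comment> \<open>If the slack stays \<open>r\<close>, then \<open>a * v\<close> equals this
      function of the other variables. Demanding that it is nonnegative makes the recovered
      \<open>v\<close> a natural number.\<close>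
    define pos where "pos = lincomb (- 1) (rest f) 0 (rest f) r"
    have pos: "affine_val pos \<tau> = r - affine_val (rest f) \<tau>" for \<tau>
      unfolding pos_def affine_val_lincomb by simp
    \<comment> \<open>This is \<open>a\<close> times \<open>g\<close> with \<open>a * v\<close>
      replaced by \<open>pos\<close>; the sign of \<open>g\<close> survives because \<open>a\<close>
      is positive.\<close>
    define elim where "elim g = lincomb a (rest g) (- fst g v) (rest f) (fst g v * r)" for g
    have elim: "affine_val (elim g) \<tau> = a * affine_val (rest g) \<tau> + fst g v * affine_val pos \<tau>" for g \<tau>
      unfolding elim_def affine_val_lincomb pos by (simp add: algebra_simps)
    have pos_bound: "bounded_by (N ^ 4) pos"
      unfolding pos_def using N4 rest_bound[OF f(1)] r0 r1 aD
      by (intro bounded_by_lincomb[where M = N and N = N]) auto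
    have elim_bound: "bounded_by (N ^ 4) (elim g)" if "g \<in> C" for g
    proof -
      have "\<bar>fst g v * r\<bar> \<le> N * (N * N)"
        unfolding abs_mult using coeff[OF that] r0 r1 aD N by (intro mult_mono) auto
      moreover have "\<bar>a\<bar> * N \<le> N * N" "\<bar>- fst g v\<bar> * N \<le> N * N"
        using a aN N coeff[OF that] by (auto intro!: mult_right_mono)
      ultimately show ?thesis
        unfolding elim_def using N4 rest_bound[OF that] rest_bound[OF f(1)]
        by (intro bounded_by_lincomb[where M = N and N = N]) (auto simp: algebra_simps)
    qed
    have "\<exists>\<tau>. (\<forall>f\<in>insert pos (elim ` C). 0 \<le> affine_val f \<tau>) \<and>
      (\<forall>x\<in>V. int (\<tau> x) \<le> ?B \<and> a * D dvd int (\<tau> x) - int (\<sigma> x))"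
    proof (rule IH)
      show "1 \<le> a * D" using r0 r1 by simp
      show "a * D \<le> N ^ 4" using aD N4(3) by simp
      show "fst g x = 0" if "g \<in> insert pos (elim ` C)" "x \<notin> V" for g x
        using that rest_supp[OF _ that(2)] rest_supp[OF f(1) that(2)]
        unfolding pos_def elim_def by (auto simp: fst_lincomb)
      have "affine_val (elim g) \<sigma> = a * affine_val g (\<sigma>(v := t))" for g
        unfolding elim pos a_t[symmetric] val by (simp add: algebra_simps)
      then have "0 \<le> affine_val (elim g) \<sigma>" if "g \<in> C" for g
        using t that a unfolding good_def by simp
      moreover have "0 \<le> affine_val pos \<sigma>" unfolding pos a_t[symmetric] using a by simp
      ultimately show "0 \<le> affine_val g \<sigma>" if "g \<in> insert pos (elim ` C)" for g
        using that by auto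
    qed (use pos_bound elim_bound in auto)
    then obtain \<tau> where \<tau>: "0 \<le> affine_val pos \<tau>" "\<And>g. g \<in> C \<Longrightarrow> 0 \<le> affine_val (elim g) \<tau>"
      "\<And>x. x \<in> V \<Longrightarrow> int (\<tau> x) \<le> ?B" "\<And>x. x \<in> V \<Longrightarrow> a * D dvd int (\<tau> x) - int (\<sigma> x)"
      by auto
    \<comment> \<open>As \<open>pos\<close> has the value \<open>a * t\<close> at \<sigma>,
      congruence modulo \<open>a * D\<close> does two things: the value at \<tau> is divisible by
      \<open>a\<close>, and the quotient is congruent to \<open>t\<close> modulo
      \<open>D\<close>.\<close>
    have "a * D dvd affine_val pos \<tau> - affine_val pos \<sigma>"
      using rest_supp[OF f(1)] by (intro affine_val_dvd \<tau>(4)) (auto simp: pos_def fst_lincomb)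
    then obtain q where "affine_val pos \<tau> - affine_val pos \<sigma> = a * D * q" by (elim dvdE)
    then have q: "affine_val pos \<tau> = a * (int t + D * q)"
      by (simp add: pos[of \<sigma>] a_t[symmetric] algebra_simps)
    define u where "u = nat (int t + D * q)"
    have "0 \<le> int t + D * q" using \<tau>(1) a unfolding q by (simp add: zero_le_mult_iff)
    then have u: "int u = int t + D * q" unfolding u_def by simp
    have au: "affine_val pos \<tau> = a * int u" unfolding q u ..
    show ?thesis
    proof (rule finish)
      show "int (\<tau> x) \<le> ?B \<and> D dvd int (\<tau> x) - int (\<sigma> x)" if "x \<in> V" for x
        using \<tau>(3,4)[OF that] by (metis dvd_mult_right)
      have "D dvd (int t - int (\<sigma> v)) + D * q" using t unfolding good_def by (intro dvd_add) auto
      then show "D dvd int u - int (\<sigma> v)" unfolding u by (simp add: algebra_simps)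
      show "0 \<le> affine_val g (\<tau>(v := u))" if "g \<in> C" for g
      proof -
        have "affine_val (elim g) \<tau> = a * affine_val g (\<tau>(v := u))"
          unfolding elim au val by (simp add: algebra_simps)
        with \<tau>(2)[OF that] a show ?thesis by (simp add: zero_le_mult_iff)
      qed
      \<comment> \<open>The solution for \<open>v\<close> inherits its size from a sum with one term
        per variable, each at most \<open>N * ?B\<close>; there are at most \<open>N\<close>
        variables.\<close>
      have "\<bar>affine_val (rest f) \<tau>\<bar> \<le> int (card (UNIV :: 'v set)) * (N * ?B) + N"
        using rest_supp[OF f(1)] B1 by (intro affine_val_bound rest_bound f(1) \<tau>(3)) auto
      also have "\<dots> \<le> N * (N * ?B) + N"
        using insert.prems(2) N B1 by (intro add_right_mono mult_right_mono) auto
      finally have *: "\<bar>affine_val (rest f) \<tau>\<bar> \<le> N * N * ?B + N" by (simp add: mult.assoc)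
      have "1 * int u \<le> a * int u" using a by (intro mult_right_mono) auto
      also have "\<dots> = r - affine_val (rest f) \<tau>" using au pos by simp
      also have "\<dots> \<le> N * N * ?B + (N + N * N)" using * r1 aD by linarith
      also have "\<dots> \<le> N * N * ?B + (N + N * N) * ?B"
        using B1 N mult_left_mono[of 1 ?B "N + N * N"] by simp
      also have "\<dots> = (N * N + (N + N * N)) * ?B" by (simp add: algebra_simps)
      also have "\<dots> \<le> N ^ 4 * ?B"
        using sq N_le cube four B1 by (intro mult_right_mono) linarith+
      finally show "int u \<le> N ^ 4 * ?B" by simp
    qed
  qed
qed

text \<open>One direction is enough: over the integers \<open>f < 0\<close> means
  \<open>0 \<le> - f - 1\<close>, so negativity is transferred too, at the price of 1 in the
  bound.\<close>

definition sign_equiv :: "int \<Rightarrow> ('v::finite \<Rightarrow> nat) \<Rightarrow> ('v \<Rightarrow> nat) \<Rightarrow> bool" where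
  "sign_equiv N \<sigma> \<tau> \<longleftrightarrow> (\<forall>f. bounded_by N f \<longrightarrow> 0 \<le> affine_val f \<sigma> \<longrightarrow> 0 \<le> affine_val f \<tau>)"

text \<open>Eliminate all variables with modulus 1, the constraints being all bounded functions that
  are nonnegative at \<sigma>.\<close>

lemma small_model:
  fixes \<sigma> :: "'v::finite \<Rightarrow> nat"
  assumes "2 \<le> N" "int (card (UNIV :: 'v set)) \<le> N"
  shows "\<exists>\<tau>. sign_equiv N \<sigma> \<tau> \<and> (\<forall>x. int (\<tau> x) \<le> N ^ small_exp (card (UNIV :: 'v set)))"
proof -
  have "\<exists>\<tau>. (\<forall>f\<in>{f. bounded_by N f \<and> 0 \<le> affine_val f \<sigma>}. 0 \<le> affine_val f \<tau>) \<and>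
      (\<forall>x\<in>UNIV. int (\<tau> x) \<le> N ^ small_exp (card (UNIV :: 'v set)) \<and> 1 dvd int (\<tau> x) - int (\<sigma> x))"
    by (rule small_model_aux) (use assms in auto)
  then show ?thesis unfolding sign_equiv_def by blast
qed

section \<open>Evaluation on codes\<close>

text \<open>Fractions stay unreduced, so products and pairing suffice. \<open>nnrat_code\<close> has
  the same format, hence the payload of a coded constant is already its value.\<close>

definition frac_add :: "nat \<Rightarrow> nat \<Rightarrow> nat" where
  "frac_add x y = prod_encode (pfst x * psnd y + pfst y * psnd x, psnd x * psnd y)"

text \<open>Over the common denominator, subtraction of naturals truncates exactly where
  \<open>Monus\<close> does.\<close>

definition frac_monus :: "nat \<Rightarrow> nat \<Rightarrow> nat" where
  "frac_monus x y = prod_encode (pfst x * psnd y - pfst y * psnd x, psnd x * psnd y)"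

definition frac_mult :: "nat \<Rightarrow> nat \<Rightarrow> nat" where
  "frac_mult x y = prod_encode (pfst x * pfst y, psnd x * psnd y)"

definition frac_less :: "nat \<Rightarrow> nat \<Rightarrow> bool" where
  "frac_less x y \<longleftrightarrow> pfst x * psnd y < pfst y * psnd x"

definition encodes_real :: "nat \<Rightarrow> real \<Rightarrow> bool" where
  "encodes_real x v \<longleftrightarrow> psnd x > 0 \<and> v = real (pfst x) / real (psnd x)"

text \<open>A pair with denominator 0 represents \<open>\<infinity>\<close>; \<^const>\<open>frac_add\<close> respects this.\<close>

definition encodes_ennreal :: "nat \<Rightarrow> ennreal \<Rightarrow> bool" where
  "encodes_ennreal x v \<longleftrightarrow> v = (if psnd x = 0 then \<infinity> else ennreal (real (pfst x) / real (psnd x)))"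

lemma encodes_real_add:
  "encodes_real x u \<Longrightarrow> encodes_real y v \<Longrightarrow> encodes_real (frac_add x y) (u + v)"
  unfolding encodes_real_def frac_add_def by (auto simp: field_simps)

lemma encodes_real_mult:
  "encodes_real x u \<Longrightarrow> encodes_real y v \<Longrightarrow> encodes_real (frac_mult x y) (u * v)"
  unfolding encodes_real_def frac_mult_def by auto

lemma frac_less_iff:
  assumes "encodes_real x u" "encodes_real y v"
  shows "frac_less x y \<longleftrightarrow> u < v"
proof -
  have "frac_less x y \<longleftrightarrow> real (pfst x * psnd y) < real (pfst y * psnd x)"
    unfolding frac_less_def of_nat_less_iff ..
  then show ?thesis
    using assms unfolding encodes_real_def by (auto simp: field_simps)
qed

lemma encodes_real_monus:
  assumes "encodes_real x u" "encodes_real y v"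
  shows "encodes_real (frac_monus x y) (max 0 (u - v))"
proof (cases "frac_less x y")
  case True
  then have "max 0 (u - v) = 0" using frac_less_iff[OF assms] by simp
  with True assms show ?thesis
    unfolding encodes_real_def frac_monus_def frac_less_def by simp
next
  case False
  then have "max 0 (u - v) = u - v" using frac_less_iff[OF assms] by simp
  with False assms show ?thesis
    unfolding encodes_real_def frac_monus_def frac_less_def
    by (auto simp: of_nat_diff field_simps)
qed

lemma encodes_ennreal_add:
  "encodes_ennreal x u \<Longrightarrow> encodes_ennreal y v \<Longrightarrow> encodes_ennreal (frac_add x y) (u + v)"
  unfolding encodes_ennreal_def frac_add_def
  by (auto simp: ennreal_plus[symmetric] add_frac_eq simp del: ennreal_plus)

text \<open>Cross-multiplication decides nothing when a denominator is 0, so the infinite cases are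
  split off first. The right-hand side is the test that the final program evaluates.\<close>

lemma encodes_ennreal_le:
  assumes "encodes_ennreal x u" "encodes_ennreal y v"
  shows "u \<le> v \<longleftrightarrow> psnd y = 0 \<or> psnd x \<noteq> 0 \<and> \<not> frac_less y x"
proof (cases "psnd x = 0 \<or> psnd y = 0")
  case True
  with assms show ?thesis unfolding encodes_ennreal_def by (auto simp: top_unique)
next
  case False
  then have "encodes_real x (pfst x / psnd x)" "encodes_real y (pfst y / psnd y)"
    unfolding encodes_real_def by auto
  from frac_less_iff[OF this(2,1)] False assms show ?thesis
    unfolding encodes_ennreal_def by (simp add: not_less ennreal_le_iff)
qed

lemma computable_frac [comp_intros]:
  assumes "computable k a" "computable k b"
  shows "computable k (\<lambda>xs. frac_add (a xs) (b xs))"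
    "computable k (\<lambda>xs. frac_monus (a xs) (b xs))"
    "computable k (\<lambda>xs. frac_mult (a xs) (b xs))"
    "computable k (\<lambda>xs. of_bool (frac_less (a xs) (b xs)))"
  unfolding frac_add_def frac_monus_def frac_mult_def frac_less_def
  by (intro comp_intros assms)+

text \<open>In the course-of-values recursions below, the value at an earlier code \<open>i < n\<close> is
  \<open>lookup h (n - Suc i)\<close>.\<close>

definition lexpr_step :: "nat \<Rightarrow> nat \<Rightarrow> nat \<Rightarrow> nat" where
  "lexpr_step h n s =
    (if pfst n = 0 then psnd n
     else if pfst n = 1 then prod_encode (lookup s (psnd n), 1)
     else if pfst n = 2 then frac_mult (pfst (psnd n)) (lookup h (n - Suc (psnd (psnd n))))
     else if pfst n = 3 then
       frac_add (lookup h (n - Suc (pfst (psnd n)))) (lookup h (n - Suc (psnd (psnd n))))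
     else frac_monus (lookup h (n - Suc (pfst (psnd n)))) (lookup h (n - Suc (psnd (psnd n)))))"

text \<open>Arguments of another sort are evaluated by a nested recursion, those of the same sort by
  lookup. Tags that code nothing fall into the last branch, which keeps the step total.\<close>

definition guard_step :: "nat \<Rightarrow> nat \<Rightarrow> nat \<Rightarrow> nat" where
  "guard_step h n s =
    (if pfst n = 0 then
       of_bool (frac_less (cov_rec lexpr_step (pfst (psnd n)) s) (cov_rec lexpr_step (psnd (psnd n)) s))
     else if pfst n = 1 then
       lookup h (n - Suc (pfst (psnd n))) * lookup h (n - Suc (psnd (psnd n)))
     else 1 - lookup h (n - Suc (psnd n)))"

text \<open>A failing guard returns the fraction 0/1 outright: multiplying by 0 would keep a
  denominator 0 and miss \<open>0 * \<infinity> = 0\<close>. The \<open>- 1\<close> undoes the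
  \<open>Suc\<close> in \<open>ext_lexpr_code\<close>.\<close>

definition linexp_step :: "nat \<Rightarrow> nat \<Rightarrow> nat \<Rightarrow> nat" where
  "linexp_step h n s =
    (if pfst n = 0 then
       if psnd n = 0 then prod_encode (1, 0) else cov_rec lexpr_step (psnd n - 1) s
     else if pfst n = 1 then
       if cov_rec guard_step (pfst (psnd n)) s = 0 then prod_encode (0, 1)
       else lookup h (n - Suc (psnd (psnd n)))
     else frac_add (lookup h (n - Suc (pfst (psnd n)))) (lookup h (n - Suc (psnd (psnd n)))))"

lemma computable_lexpr_step: "computable 3 (\<lambda>xs. lexpr_step (xs ! 0) (xs ! 1) (xs ! 2))"
  unfolding lexpr_step_def by (intro comp_intros) simp_all

lemma computable_guard_step: "computable 3 (\<lambda>xs. guard_step (xs ! 0) (xs ! 1) (xs ! 2))"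
  unfolding guard_step_def
  by (intro comp_intros computable_cov_rec[OF computable_lexpr_step]) simp_all

lemma computable_linexp_step: "computable 3 (\<lambda>xs. linexp_step (xs ! 0) (xs ! 1) (xs ! 2))"
  unfolding linexp_step_def
  by (intro comp_intros computable_cov_rec[OF computable_lexpr_step]
      computable_cov_rec[OF computable_guard_step]) simp_all

definition state_of :: "('v \<Rightarrow> nat) \<Rightarrow> nat \<Rightarrow> 'v \<Rightarrow> nat" where
  "state_of c s x = lookup s (c x)"

text \<open>Strictness needs a positive tag, as \<open>prod_encode (0, 0) = 0\<close>. Every
  constructor with an argument of its own sort has one, so each recursive lookup stays within the
  history.\<close>

lemma less_prod_encode: "0 < t \<Longrightarrow> b < prod_encode (t, b)"
  by (simp add: prod_encode_def) (cases t; simp; linarith?)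

lemma less_prod_encode_pair:
  assumes "0 < t" shows "a < prod_encode (t, prod_encode (a, b))" "b < prod_encode (t, prod_encode (a, b))"
  using less_prod_encode[OF assms] le_prod_encode_1[of a b] le_prod_encode_2[of b a]
  by (auto intro: le_less_trans)

lemma nnrat_code_eq:
  obtains p q where "nnrat_code r = prod_encode (p, q)" "0 < q"
    "real_of_rat (rat_of_nnrat r) = real p / real q"
proof -
  obtain p q where pq: "quotient_of (rat_of_nnrat r) = (p, q)" by fastforce
  have q: "0 < q" using quotient_of_denom_pos[OF pq] .
  have eq: "rat_of_nnrat r = of_int p / of_int q" using quotient_of_div[OF pq] .
  have "0 \<le> rat_of_nnrat r" using rat_of_nnrat by auto
  then have "0 \<le> p" using q unfolding eq by (simp add: zero_le_divide_iff)
  with q eq that[of "nat p" "nat q"] pq show thesis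
    by (auto simp: nnrat_code_def of_rat_divide)
qed

lemma cov_rec_lexpr_step:
  fixes c s
  defines "ev e \<equiv> cov_rec lexpr_step (lexpr_code c e) s"
  shows "ev (Const r) = nnrat_code r"
    "ev (Var x) = prod_encode (lookup s (c x), 1)"
    "ev (Scale r e) = frac_mult (nnrat_code r) (ev e)"
    "ev (Plus e e') = frac_add (ev e) (ev e')"
    "ev (Monus e e') = frac_monus (ev e) (ev e')"
  unfolding ev_def
  by (subst cov_rec_def, simp add: lexpr_step_def lookup_history less_prod_encode_pair)+

lemma encodes_lexpr:
  "encodes_real (cov_rec lexpr_step (lexpr_code c e) s) (lexpr_val e (state_of c s))"
proof (induction e)
  case (Const r)
  then show ?case
    by (rule nnrat_code_eq[of r]) (simp add: cov_rec_lexpr_step encodes_real_def del: lexpr_code.simps)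
next
  case (Var x)
  show ?case
    by (simp add: cov_rec_lexpr_step encodes_real_def state_of_def del: lexpr_code.simps)
next
  case (Scale r e)
  obtain p q where "nnrat_code r = prod_encode (p, q)" "0 < q"
    "real_of_rat (rat_of_nnrat r) = real p / real q" by (rule nnrat_code_eq)
  then have "encodes_real (nnrat_code r) (real_of_rat (rat_of_nnrat r))"
    by (simp add: encodes_real_def)
  from encodes_real_mult[OF this Scale] show ?case
    by (simp add: cov_rec_lexpr_step del: lexpr_code.simps)
qed (simp_all add: cov_rec_lexpr_step encodes_real_add encodes_real_monus del: lexpr_code.simps)

lemma cov_rec_guard_step:
  fixes c s
  defines "ev \<phi> \<equiv> cov_rec guard_step (guard_code c \<phi>) s"
  shows "ev (Less e e') =
      of_bool (frac_less (cov_rec lexpr_step (lexpr_code c e) s) (cov_rec lexpr_step (lexpr_code c e') s))"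
    "ev (Conj \<phi> \<psi>) = ev \<phi> * ev \<psi>"
    "ev (Neg \<phi>) = 1 - ev \<phi>"
  unfolding ev_def
  by (subst cov_rec_def,
      simp add: guard_step_def lookup_history less_prod_encode_pair less_prod_encode)+

lemma decides_guard:
  "cov_rec guard_step (guard_code c \<phi>) s = of_bool (guard_val \<phi> (state_of c s))"
  by (induction \<phi>)
    (simp_all add: cov_rec_guard_step frac_less_iff[OF encodes_lexpr encodes_lexpr] del: guard_code.simps)

lemma cov_rec_linexp_step:
  fixes c s
  defines "ev h \<equiv> cov_rec linexp_step (linexp_code c h) s"
  shows "ev (Base (Finite e)) = cov_rec lexpr_step (lexpr_code c e) s"
    "ev (Base Infinity) = prod_encode (1, 0)"
    "ev (Guarded \<phi> h) =
      (if cov_rec guard_step (guard_code c \<phi>) s = 0 then prod_encode (0, 1) else ev h)"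
    "ev (Add h h') = frac_add (ev h) (ev h')"
  unfolding ev_def
  by (subst cov_rec_def, simp add: linexp_step_def lookup_history less_prod_encode_pair)+

lemma encodes_linexp:
  "encodes_ennreal (cov_rec linexp_step (linexp_code c h) s) (linexp_val h (state_of c s))"
proof (induction h)
  case (Base t)
  show ?case
    using encodes_lexpr[of c _ s]
    by (cases t)
      (auto simp: cov_rec_linexp_step encodes_ennreal_def encodes_real_def simp del: linexp_code.simps)
next
  case (Guarded \<phi> h)
  then show ?case
    by (cases "guard_val \<phi> (state_of c s)")
      (simp_all add: cov_rec_linexp_step decides_guard encodes_ennreal_def del: linexp_code.simps)
qed (simp add: cov_rec_linexp_step encodes_ennreal_add del: linexp_code.simps)

section \<open>Bounded counterexamples\<close>

text \<open>Throughout, \<open>u\<close> and \<open>v\<close> are the values of one expression at \<open>\<sigma>\<close> and \<open>\<tau>\<close>.\<close>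

definition linear_pair ::
  "int \<Rightarrow> ('v::finite \<Rightarrow> nat) \<Rightarrow> ('v \<Rightarrow> nat) \<Rightarrow> real \<Rightarrow> real \<Rightarrow> bool" where
  "linear_pair W \<sigma> \<tau> u v \<longleftrightarrow> (\<exists>f d. bounded_by W f \<and> 0 < d \<and> d \<le> W \<and>
     u = of_int (affine_val f \<sigma>) / of_int d \<and> v = of_int (affine_val f \<tau>) / of_int d)"

lemma linear_pair_mono: "linear_pair W \<sigma> \<tau> u v \<Longrightarrow> W \<le> W' \<Longrightarrow> linear_pair W' \<sigma> \<tau> u v"
  unfolding linear_pair_def by (elim exE conjE) (intro exI conjI; (assumption | simp add: bounded_by_mono))

lemma linear_pair_const:
  assumes "p \<le> W" "q \<le> W" "0 < q"
  shows "linear_pair (int W) \<sigma> \<tau> (real p / real q) (real p / real q)"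
  unfolding linear_pair_def
  by (rule exI[of _ "(\<lambda>x. 0, int p)"], rule exI[of _ "int q"])
    (use assms in \<open>auto simp: bounded_by_def affine_val_def\<close>)

lemma linear_pair_var: "linear_pair 1 \<sigma> \<tau> (real (\<sigma> x)) (real (\<tau> x))"
proof -
  have "affine_val (\<lambda>y. if y = x then 1 else 0, 0) \<upsilon> = int (\<upsilon> x)" for \<upsilon> :: "'a \<Rightarrow> nat"
    unfolding affine_val_def by (simp add: if_distrib[of "\<lambda>z. z * _"] cong: if_cong)
  then show ?thesis
    unfolding linear_pair_def
    by (intro exI[of _ "(\<lambda>y. if y = x then 1 else 0, 0)"] exI[of _ 1])
      (auto simp: bounded_by_def)
qed

lemma linear_pair_scale:
  assumes "linear_pair W \<sigma> \<tau> u v" "p \<le> R" "q \<le> R" "0 < q"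
  shows "linear_pair (int R * W) \<sigma> \<tau> (real p / real q * u) (real p / real q * v)"
proof -
  obtain f d where f: "bounded_by W f" "0 < d" "d \<le> W"
    "u = of_int (affine_val f \<sigma>) / of_int d" "v = of_int (affine_val f \<tau>) / of_int d"
    using assms(1) unfolding linear_pair_def by auto
  let ?g = "lincomb (int p) f 0 f 0"
  have "bounded_by (int R * W) ?g"
    using assms(2) f(2,3) by (intro bounded_by_lincomb[OF f(1) f(1)]) (auto intro: mult_right_mono)
  moreover have "int q * d \<le> int R * W" using assms(3) f(2,3) by (intro mult_mono) auto
  moreover have "0 < int q * d" using assms(4) f(2) by simp
  ultimately show ?thesis
    unfolding linear_pair_def f(4,5)
    by (intro exI[of _ ?g] exI[of _ "int q * d"]) (auto simp: affine_val_lincomb)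
qed

text \<open>Over the common denominator \<open>d * d'\<close> each numerator is bounded by
  \<open>W * W'\<close>, whence the factor 2. The sign \<open>k\<close> covers \<open>Plus\<close>
  and \<open>Monus\<close> above truncation.\<close>

lemma linear_pair_lincomb:
  assumes "linear_pair W \<sigma> \<tau> u v" "linear_pair W' \<sigma> \<tau> u' v'" "\<bar>k\<bar> = 1"
  shows "linear_pair (2 * W * W') \<sigma> \<tau> (u + of_int k * u') (v + of_int k * v')"
proof -
  obtain f d where f: "bounded_by W f" "0 < d" "d \<le> W"
    "u = of_int (affine_val f \<sigma>) / of_int d" "v = of_int (affine_val f \<tau>) / of_int d"
    using assms(1) unfolding linear_pair_def by auto
  obtain g d' where g: "bounded_by W' g" "0 < d'" "d' \<le> W'"
    "u' = of_int (affine_val g \<sigma>) / of_int d'" "v' = of_int (affine_val g \<tau>) / of_int d'"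
    using assms(2) unfolding linear_pair_def by auto
  let ?g = "lincomb d' f (k * d) g 0"
  have *: "d' * W \<le> W * W'" "d * W' \<le> W * W'" "d * d' \<le> W * W'" "0 < W * W'"
    using f(2,3) g(2,3) mult_right_mono[of d' W' W] mult_mono[of d W d' W']
    by (auto simp: mult.commute)
  then have "bounded_by (2 * W * W') ?g"
    using f(2) g(2) assms(3) by (intro bounded_by_lincomb[OF f(1) g(1)]) (simp add: abs_mult)
  moreover have "d * d' \<le> 2 * W * W'" using * by linarith
  moreover have "0 < d * d'" using f(2) g(2) by simp
  ultimately show ?thesis
    using f(2) g(2) unfolding linear_pair_def f(4,5) g(4,5)
    by (intro exI[of _ ?g] exI[of _ "d * d'"]) (auto simp: affine_val_lincomb field_simps)
qed

text \<open>Cleared of denominators, \<open>u < u'\<close> and its negation become nonnegativity of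
  \<open>d * g - d' * f - 1\<close> and of \<open>d' * f - d * g\<close>. Both are bounded by
  \<open>2 * W * W' + 1\<close>, hence by \<open>4 * W * W'\<close>, so each carries over from
  \<sigma> to \<tau>.\<close>

lemma linear_pair_less_iff:
  assumes "sign_equiv N \<sigma> \<tau>" "linear_pair W \<sigma> \<tau> u v" "linear_pair W' \<sigma> \<tau> u' v'" "4 * W * W' \<le> N"
  shows "u < u' \<longleftrightarrow> v < v'"
proof -
  obtain f d where f: "bounded_by W f" "0 < d" "d \<le> W"
    "u = of_int (affine_val f \<sigma>) / of_int d" "v = of_int (affine_val f \<tau>) / of_int d"
    using assms(2) unfolding linear_pair_def by auto
  obtain g d' where g: "bounded_by W' g" "0 < d'" "d' \<le> W'"
    "u' = of_int (affine_val g \<sigma>) / of_int d'" "v' = of_int (affine_val g \<tau>) / of_int d'"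
    using assms(3) unfolding linear_pair_def by auto
  have *: "d' * W \<le> W * W'" "d * W' \<le> W * W'" "0 < W * W'"
    using f(2,3) g(2,3) mult_right_mono[of d' W' W] mult_mono[of d W d' W']
    by (auto simp: mult.commute)
  have less_iff: "real_of_int a / of_int d < of_int b / of_int d' \<longleftrightarrow> d' * a < d * b" for a b
  proof -
    have "real_of_int a / of_int d < of_int b / of_int d' \<longleftrightarrow> real_of_int (d' * a) < real_of_int (d * b)"
      using f(2) g(2) by (simp add: field_simps)
    then show ?thesis by (simp only: of_int_less_iff)
  qed
  let ?less = "lincomb d g (- d') f (- 1)"
  let ?ge = "lincomb d' f (- d) g 0"
  have "bounded_by N ?less" "bounded_by N ?ge"
    using f(2) g(2) * assms(4)
    by (auto intro!: bounded_by_lincomb[OF g(1) f(1)] bounded_by_lincomb[OF f(1) g(1)])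
  then have "0 \<le> affine_val ?less \<sigma> \<Longrightarrow> 0 \<le> affine_val ?less \<tau>"
    "0 \<le> affine_val ?ge \<sigma> \<Longrightarrow> 0 \<le> affine_val ?ge \<tau>"
    using assms(1) unfolding sign_equiv_def by blast+
  then show ?thesis
    unfolding f(4,5) g(4,5) less_iff affine_val_lincomb by linarith
qed

section \<open>Codes as bounds on coefficients\<close>

lemma sum_le_prod_encode: "a + b \<le> prod_encode (a, b)"
proof -
  have "n \<le> triangle n" for n by (induction n) auto
  from this[of "a + b"] show ?thesis by (simp add: prod_encode_def trans_le_add1)
qed

text \<open>The strictness pays for the factor 2 in \<open>linear_pair_lincomb\<close>:
  \<open>2 * 2 ^ a * 2 ^ b\<close> is still at most 2 to the power of the code.\<close>

lemma sum_less_prod_encode: "0 < t \<Longrightarrow> a + b < prod_encode (t, prod_encode (a, b))"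
  using less_prod_encode sum_le_prod_encode by (rule le_less_trans[rotated])

lemma pow2_le_trans: "2 ^ m \<le> N \<Longrightarrow> k \<le> m \<Longrightarrow> 2 ^ k \<le> (N :: int)"
  by (meson order_trans power_increasing one_le_numeral)

text \<open>The critical case is \<open>Monus\<close>: by \<open>linear_pair_less_iff\<close> it is
  truncated at both states or at neither, so one affine function serves both. The 2 in the exponent
  is the factor 4 of that comparison.\<close>

lemma linear_pair_lexpr:
  assumes "sign_equiv N \<sigma> \<tau>" "2 ^ (lexpr_code c e + 2) \<le> N"
  shows "linear_pair (2 ^ lexpr_code c e) \<sigma> \<tau> (lexpr_val e \<sigma>) (lexpr_val e \<tau>)"
  using assms(2)
proof (induction e)
  case (Const r)
  obtain p q where r: "nnrat_code r = prod_encode (p, q)" "0 < q"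
    "real_of_rat (rat_of_nnrat r) = real p / real q" by (rule nnrat_code_eq)
  have "p + q \<le> lexpr_code c (Const r)"
    using sum_le_prod_encode[of p q] sum_le_prod_encode[of 0 "prod_encode (p, q)"] r(1) by simp
  also have "\<dots> \<le> 2 ^ lexpr_code c (Const r)" by (rule less_imp_le[OF less_exp])
  finally show ?case
    using linear_pair_const[of p "2 ^ lexpr_code c (Const r)" q \<sigma> \<tau>] r by simp
next
  case (Var x)
  show ?case by (rule linear_pair_mono[OF _ one_le_power]) (auto simp: linear_pair_var)
next
  case (Scale r e)
  obtain p q where r: "nnrat_code r = prod_encode (p, q)" "0 < q"
    "real_of_rat (rat_of_nnrat r) = real p / real q" by (rule nnrat_code_eq)
  have le: "nnrat_code r + lexpr_code c e \<le> lexpr_code c (Scale r e)"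
    using sum_less_prod_encode[of 2 "nnrat_code r" "lexpr_code c e"] by simp
  then have "(2 :: int) ^ (lexpr_code c e + 2) \<le> 2 ^ (lexpr_code c (Scale r e) + 2)"
    by (intro power_increasing) auto
  with Scale have IH: "linear_pair (2 ^ lexpr_code c e) \<sigma> \<tau> (lexpr_val e \<sigma>) (lexpr_val e \<tau>)"
    by (meson order_trans)
  have "p \<le> 2 ^ nnrat_code r" "q \<le> 2 ^ nnrat_code r"
    using sum_le_prod_encode[of p q] less_exp[of "nnrat_code r"] r(1) by linarith+
  from linear_pair_scale[OF IH this r(2)]
  have "linear_pair (2 ^ (nnrat_code r + lexpr_code c e)) \<sigma> \<tau>
      (lexpr_val (Scale r e) \<sigma>) (lexpr_val (Scale r e) \<tau>)"
    using r(3) by (simp add: power_add)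
  then show ?case by (rule linear_pair_mono) (rule power_increasing; use le in linarith)
next
  case (Plus e1 e2)
  have le: "lexpr_code c e1 + lexpr_code c e2 < lexpr_code c (Plus e1 e2)"
    using sum_less_prod_encode by simp
  then have "(2 :: int) ^ (lexpr_code c e1 + 2) \<le> 2 ^ (lexpr_code c (Plus e1 e2) + 2)"
    "(2 :: int) ^ (lexpr_code c e2 + 2) \<le> 2 ^ (lexpr_code c (Plus e1 e2) + 2)"
    by (intro power_increasing; linarith)+
  with Plus have "linear_pair (2 ^ lexpr_code c e1) \<sigma> \<tau> (lexpr_val e1 \<sigma>) (lexpr_val e1 \<tau>)"
    "linear_pair (2 ^ lexpr_code c e2) \<sigma> \<tau> (lexpr_val e2 \<sigma>) (lexpr_val e2 \<tau>)"
    by (meson order_trans)+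
  from linear_pair_lincomb[OF this, of 1]
  have "linear_pair (2 ^ Suc (lexpr_code c e1 + lexpr_code c e2)) \<sigma> \<tau>
      (lexpr_val (Plus e1 e2) \<sigma>) (lexpr_val (Plus e1 e2) \<tau>)"
    by (simp add: power_add mult.assoc)
  then show ?case
    by (rule linear_pair_mono) (rule power_increasing; use le in linarith)
next
  case (Monus e1 e2)
  have le: "lexpr_code c e1 + lexpr_code c e2 < lexpr_code c (Monus e1 e2)"
    using sum_less_prod_encode by simp
  then have pow: "(2 :: int) ^ (lexpr_code c e1 + 2) \<le> 2 ^ (lexpr_code c (Monus e1 e2) + 2)"
    "(2 :: int) ^ (lexpr_code c e2 + 2) \<le> 2 ^ (lexpr_code c (Monus e1 e2) + 2)"
    "(2 :: int) ^ (lexpr_code c e1 + lexpr_code c e2 + 2) \<le> 2 ^ (lexpr_code c (Monus e1 e2) + 2)"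
    by (intro power_increasing; linarith)+
  with Monus have IH: "linear_pair (2 ^ lexpr_code c e1) \<sigma> \<tau> (lexpr_val e1 \<sigma>) (lexpr_val e1 \<tau>)"
    "linear_pair (2 ^ lexpr_code c e2) \<sigma> \<tau> (lexpr_val e2 \<sigma>) (lexpr_val e2 \<tau>)"
    by (meson order_trans)+
  have "4 * 2 ^ lexpr_code c e1 * 2 ^ lexpr_code c e2 \<le> N"
    using pow(3) Monus.prems by (simp add: power_add mult_ac)
  from linear_pair_less_iff[OF assms(1) IH this]
  have iff: "lexpr_val e1 \<sigma> < lexpr_val e2 \<sigma> \<longleftrightarrow> lexpr_val e1 \<tau> < lexpr_val e2 \<tau>" .
  show ?case
  proof (cases "lexpr_val e1 \<sigma> < lexpr_val e2 \<sigma>")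
    case True
    with iff have "lexpr_val (Monus e1 e2) \<sigma> = 0" "lexpr_val (Monus e1 e2) \<tau> = 0" by auto
    with linear_pair_const[of 0 1 1 \<sigma> \<tau>] show ?thesis
      by (auto intro: linear_pair_mono simp del: lexpr_code.simps)
  next
    case False
    with linear_pair_lincomb[OF IH, of "- 1"] iff
    have "linear_pair (2 ^ Suc (lexpr_code c e1 + lexpr_code c e2)) \<sigma> \<tau>
        (lexpr_val (Monus e1 e2) \<sigma>) (lexpr_val (Monus e1 e2) \<tau>)"
      by (simp add: power_add mult.assoc max_def)
    then show ?thesis
      by (rule linear_pair_mono) (rule power_increasing; use le in linarith)
  qed
qed

lemma guard_val_sign_equiv:
  assumes "sign_equiv N \<sigma> \<tau>" "2 ^ (guard_code c \<phi> + 2) \<le> N"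
  shows "guard_val \<phi> \<sigma> \<longleftrightarrow> guard_val \<phi> \<tau>"
  using assms(2)
proof (induction \<phi>)
  case (Less e1 e2)
  \<comment> \<open>Tag 0 gives no strict inequality, but no numerators are added here; the
    comparison costs only the factor 4 provided by the assumption.\<close>
  have le: "lexpr_code c e1 + lexpr_code c e2 \<le> guard_code c (Less e1 e2)"
    using sum_le_prod_encode[of "lexpr_code c e1" "lexpr_code c e2"]
      sum_le_prod_encode[of 0 "prod_encode (lexpr_code c e1, lexpr_code c e2)"] by simp
  have pow: "2 ^ n \<le> N" if "n \<le> lexpr_code c e1 + lexpr_code c e2 + 2" for n
    by (rule pow2_le_trans[OF Less]) (use le that in linarith)
  have "4 * 2 ^ lexpr_code c e1 * 2 ^ lexpr_code c e2 \<le> N"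
    using pow[of "lexpr_code c e1 + lexpr_code c e2 + 2"] by (simp add: power_add mult_ac)
  then show ?case
    using linear_pair_less_iff[OF assms(1) linear_pair_lexpr linear_pair_lexpr] assms(1)
      pow[of "lexpr_code c e1 + 2"] pow[of "lexpr_code c e2 + 2"] by simp
next
  case (Conj \<phi> \<psi>)
  have "guard_code c \<phi> + guard_code c \<psi> \<le> guard_code c (Conj \<phi> \<psi>)"
    using sum_less_prod_encode[of 1 "guard_code c \<phi>" "guard_code c \<psi>"] by simp
  then have "2 ^ (guard_code c \<phi> + 2) \<le> N" "2 ^ (guard_code c \<psi> + 2) \<le> N"
    by (intro pow2_le_trans[OF Conj.prems]; linarith)+
  with Conj.IH show ?case by simp
next
  case (Neg \<phi>)
  have "guard_code c \<phi> \<le> guard_code c (Neg \<phi>)"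
    using less_prod_encode[of 2 "guard_code c \<phi>"] by simp
  then have "2 ^ (guard_code c \<phi> + 2) \<le> N"
    by (intro pow2_le_trans[OF Neg.prems]; linarith)+
  with Neg.IH show ?case by simp
qed

text \<open>Guards agree at the two states, so whether \<open>Infinity\<close> contributes agrees as
  well; a finite value is never paired with an infinite one.\<close>

definition ext_linear_pair ::
  "int \<Rightarrow> ('v::finite \<Rightarrow> nat) \<Rightarrow> ('v \<Rightarrow> nat) \<Rightarrow> ennreal \<Rightarrow> ennreal \<Rightarrow> bool" where
  "ext_linear_pair W \<sigma> \<tau> u v \<longleftrightarrow> u = \<infinity> \<and> v = \<infinity> \<or>
     (\<exists>a b. 0 \<le> a \<and> 0 \<le> b \<and> u = ennreal a \<and> v = ennreal b \<and> linear_pair W \<sigma> \<tau> a b)"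

lemma ext_linear_pair_mono:
  "ext_linear_pair W \<sigma> \<tau> u v \<Longrightarrow> W \<le> W' \<Longrightarrow> ext_linear_pair W' \<sigma> \<tau> u v"
  unfolding ext_linear_pair_def using linear_pair_mono by blast

lemma ext_linear_pair_zero: "ext_linear_pair 1 \<sigma> \<tau> 0 0"
  unfolding ext_linear_pair_def
  using linear_pair_const[of 0 1 1 \<sigma> \<tau>] by (intro disjI2 exI[of _ 0]) auto

lemma ext_linear_pair_add:
  assumes "ext_linear_pair W \<sigma> \<tau> u v" "ext_linear_pair W' \<sigma> \<tau> u' v'"
  shows "ext_linear_pair (2 * W * W') \<sigma> \<tau> (u + u') (v + v')"
proof (cases "u = \<infinity> \<and> v = \<infinity> \<or> u' = \<infinity> \<and> v' = \<infinity>")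
  case True
  then show ?thesis unfolding ext_linear_pair_def by auto
next
  case False
  with assms obtain a b a' b' where ab: "0 \<le> a" "0 \<le> b" "u = ennreal a" "v = ennreal b"
    "linear_pair W \<sigma> \<tau> a b" "0 \<le> a'" "0 \<le> b'" "u' = ennreal a'" "v' = ennreal b'"
    "linear_pair W' \<sigma> \<tau> a' b'"
    unfolding ext_linear_pair_def by metis
  with linear_pair_lincomb[OF ab(5,10), of 1] show ?thesis
    unfolding ext_linear_pair_def
    by (intro disjI2 exI[of _ "a + a'"] exI[of _ "b + b'"]) auto
qed

lemma ext_linear_pair_le:
  assumes "sign_equiv N \<sigma> \<tau>" "ext_linear_pair W \<sigma> \<tau> u v" "ext_linear_pair W' \<sigma> \<tau> u' v'"
    "4 * W * W' \<le> N" "v \<le> v'"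
  shows "u \<le> u'"
proof (cases "u' = \<infinity> \<and> v' = \<infinity>")
  case False
  with assms(3) obtain a' b' where ab': "0 \<le> a'" "0 \<le> b'" "u' = ennreal a'" "v' = ennreal b'"
    "linear_pair W' \<sigma> \<tau> a' b'" unfolding ext_linear_pair_def by auto
  \<comment> \<open>Since \<open>v \<le> v'\<close> and \<open>v'\<close> is finite, the infinite
    alternative for \<open>u\<close> and \<open>v\<close> is excluded.\<close>
  with assms(2,5) obtain a b where ab: "0 \<le> a" "0 \<le> b" "u = ennreal a" "v = ennreal b"
    "linear_pair W \<sigma> \<tau> a b" unfolding ext_linear_pair_def by (auto simp: top_unique)
  have "4 * W' * W \<le> N" using assms(4) by (simp add: mult_ac)
  from linear_pair_less_iff[OF assms(1) ab'(5) ab(5) this] have "a \<le> a' \<longleftrightarrow> b \<le> b'"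
    by linarith
  with assms(5) ab ab' show ?thesis by simp
qed simp

lemma ext_linear_pair_linexp:
  assumes "sign_equiv N \<sigma> \<tau>" "2 ^ (linexp_code c h + 2) \<le> N"
  shows "ext_linear_pair (2 ^ linexp_code c h) \<sigma> \<tau> (linexp_val h \<sigma>) (linexp_val h \<tau>)"
  using assms(2)
proof (induction h)
  case (Base t)
  show ?case
  proof (cases t)
    case (Finite e)
    have le: "lexpr_code c e \<le> linexp_code c (Base t)"
      using sum_le_prod_encode[of 0 "Suc (lexpr_code c e)"] Finite by simp
    then have "2 ^ (lexpr_code c e + 2) \<le> N"
      by (intro pow2_le_trans[OF Base]; linarith)+
    from linear_pair_lexpr[OF assms(1) this]
    have "linear_pair (2 ^ linexp_code c (Base t)) \<sigma> \<tau> (lexpr_val e \<sigma>) (lexpr_val e \<tau>)"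
      by (rule linear_pair_mono) (rule power_increasing; use le in linarith)
    then show ?thesis unfolding ext_linear_pair_def using lexpr_val_nonneg Finite by auto
  qed (simp add: ext_linear_pair_def)
next
  case (Guarded \<phi> h)
  have le: "guard_code c \<phi> + linexp_code c h \<le> linexp_code c (Guarded \<phi> h)"
    using sum_less_prod_encode[of 1 "guard_code c \<phi>" "linexp_code c h"] by simp
  then have pow: "2 ^ (guard_code c \<phi> + 2) \<le> N" "2 ^ (linexp_code c h + 2) \<le> N"
    by (intro pow2_le_trans[OF Guarded.prems]; linarith)+
  have "ext_linear_pair (2 ^ linexp_code c (Guarded \<phi> h)) \<sigma> \<tau> (linexp_val h \<sigma>) (linexp_val h \<tau>)"
    by (rule ext_linear_pair_mono[OF Guarded.IH[OF pow(2)]])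
      (rule power_increasing; use le in linarith)
  moreover have "ext_linear_pair (2 ^ linexp_code c (Guarded \<phi> h)) \<sigma> \<tau> 0 0"
    by (rule ext_linear_pair_mono[OF ext_linear_pair_zero]) (simp del: linexp_code.simps)
  ultimately show ?case
    using guard_val_sign_equiv[OF assms(1) pow(1)] by (simp del: linexp_code.simps)
next
  case (Add h1 h2)
  have le: "linexp_code c h1 + linexp_code c h2 < linexp_code c (Add h1 h2)"
    using sum_less_prod_encode by simp
  then have pow: "2 ^ (linexp_code c h1 + 2) \<le> N" "2 ^ (linexp_code c h2 + 2) \<le> N"
    by (intro pow2_le_trans[OF Add.prems]; linarith)+
  from ext_linear_pair_add[OF Add.IH(1)[OF pow(1)] Add.IH(2)[OF pow(2)]]
  have "ext_linear_pair (2 ^ Suc (linexp_code c h1 + linexp_code c h2)) \<sigma> \<tau>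
      (linexp_val (Add h1 h2) \<sigma>) (linexp_val (Add h1 h2) \<tau>)"
    by (simp add: power_add mult.assoc)
  then show ?case
    by (rule ext_linear_pair_mono)
      (rule power_increasing; use le in linarith)
qed

text \<open>This is \<open>N ^ small_exp k\<close> for \<open>N = 2 ^ (m + n + 2 + k)\<close>:
  \<open>m + n + 2\<close> allows for comparing the two values, and \<open>k\<close> makes
  \<open>N\<close> exceed the number of variables.\<close>

definition state_bound :: "nat \<Rightarrow> nat \<Rightarrow> nat \<Rightarrow> nat" where
  "state_bound k m n = 2 ^ ((m + n + 2 + k) * small_exp k)"

lemma linexp_le_iff_bounded:
  fixes h h' :: "'v::finite linexp" and c :: "'v \<Rightarrow> nat"
  defines "B \<equiv> state_bound (card (UNIV :: 'v set)) (linexp_code c h) (linexp_code c h')"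
  shows "h \<preceq> h' \<longleftrightarrow> (\<forall>\<tau>. (\<forall>x. \<tau> x \<le> B) \<longrightarrow> linexp_val h \<tau> \<le> linexp_val h' \<tau>)"
proof
  assume bounded: "\<forall>\<tau>. (\<forall>x. \<tau> x \<le> B) \<longrightarrow> linexp_val h \<tau> \<le> linexp_val h' \<tau>"
  let ?k = "card (UNIV :: 'v set)" and ?m = "linexp_code c h" and ?n = "linexp_code c h'"
  define N where "N = (2 :: int) ^ (?m + ?n + 2 + ?k)"
  have "int ?k < int (2 ^ ?k)" by (simp only: of_nat_less_iff less_exp)
  also have "\<dots> \<le> N" unfolding N_def of_nat_power of_nat_numeral by (rule power_increasing) auto
  finally have k: "int ?k \<le> N" by simp
  have pow: "2 ^ i \<le> N" if "i \<le> ?m + ?n + 2" for i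
    unfolding N_def using that by (intro power_increasing) auto
  show "h \<preceq> h'"
    unfolding linexp_le_def
  proof
    fix \<sigma> :: "'v \<Rightarrow> nat"
    obtain \<tau> where \<tau>: "sign_equiv N \<sigma> \<tau>" "\<And>x. int (\<tau> x) \<le> N ^ small_exp ?k"
      using small_model[of N \<sigma>] k pow[of 1] by auto
    have "\<tau> x \<le> B" for x
    proof -
      have "int (\<tau> x) \<le> int B"
        using \<tau>(2)[of x] unfolding N_def B_def state_bound_def power_mult of_nat_power of_nat_numeral .
      then show ?thesis by simp
    qed
    with bounded have "linexp_val h \<tau> \<le> linexp_val h' \<tau>" by blast
    moreover have "4 * 2 ^ ?m * 2 ^ ?n \<le> N"
      using pow[of "?m + ?n + 2"] by (simp add: power_add mult_ac)
    ultimately show "linexp_val h \<sigma> \<le> linexp_val h' \<sigma>"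
      using ext_linear_pair_le[OF \<tau>(1) ext_linear_pair_linexp[OF \<tau>(1), of c h]
          ext_linear_pair_linexp[OF \<tau>(1), of c h']] pow[of "?m + 2"] pow[of "?n + 2"] by simp
  qed
qed (auto simp: linexp_le_def)

lemma ex_state_of_eq:
  fixes \<tau> :: "'v::finite \<Rightarrow> nat"
  assumes "inj c" "\<And>x. \<tau> x \<le> B"
  shows "\<exists>s\<le>replicate_code (Suc (Max (range c))) B. state_of c s = \<tau>"
proof -
  \<comment> \<open>Positions outside the range of \<open>c\<close> are filled through
    \<open>inv c\<close> with some value of \<tau>, which is also at most \<open>B\<close>.\<close>
  obtain s where s: "s \<le> replicate_code (Suc (Max (range c))) B"
    "\<forall>i<Suc (Max (range c)). lookup s i = \<tau> (inv c i)"
    using ex_lookup_eq[of "Suc (Max (range c))" "\<lambda>i. \<tau> (inv c i)" B] assms(2) by blast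
  have "c x < Suc (Max (range c))" for x by (simp add: less_Suc_eq_le)
  then have "state_of c s = \<tau>"
    using s(2) assms(1) unfolding state_of_def by auto
  with s(1) show ?thesis by blast
qed

theorem theorem7:
  fixes c :: "'v::finite \<Rightarrow> nat"
  assumes "inj c"
  shows "decidable2 (linexp_code c) (linexp_code c) (\<lambda>h h'. h \<preceq> h')"
proof -
  let ?ev = "cov_rec linexp_step"
  define test where "test s m n \<longleftrightarrow>
    psnd (?ev n s) = 0 \<or> psnd (?ev m s) \<noteq> 0 \<and> \<not> frac_less (?ev n s) (?ev m s)" for s m n
  define S where "S m n =
    replicate_code (Suc (Max (range c))) (state_bound (card (UNIV :: 'v set)) m n)" for m n
  have "computable 3 (\<lambda>xs. of_bool (test (xs ! 0) (xs ! 1) (xs ! 2)))"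
    unfolding test_def
    by (intro comp_intros computable_cov_rec[OF computable_linexp_step]) simp_all
  \<comment> \<open>This holds for arbitrary \<open>m\<close> and \<open>n\<close>, codes or not,
    which gives termination everywhere. The \<open>Suc\<close> makes the strict bound of the
    quantifier inclusive.\<close>
  then have "computable 2 (\<lambda>xs. of_bool (\<forall>s<Suc (S (xs ! 0) (xs ! 1)). test s (xs ! 0) (xs ! 1)))"
    unfolding S_def state_bound_def by (intro comp_intros computable_all_less) simp_all
  then obtain p where p: "\<And>xs. length xs = 2 \<Longrightarrow>
      recf_eval p xs (of_bool (\<forall>s<Suc (S (xs ! 0) (xs ! 1)). test s (xs ! 0) (xs ! 1)))"
    unfolding computable_def by blast
  have eval: "recf_eval p [m, n] (of_bool (\<forall>s\<le>S m n. test s m n))" for m n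
    using p[of "[m, n]"] by (simp add: less_Suc_eq_le)
  have "h \<preceq> h' \<longleftrightarrow> (\<forall>s\<le>S (linexp_code c h) (linexp_code c h').
      test s (linexp_code c h) (linexp_code c h'))" (is "_ \<longleftrightarrow> ?test") for h h'
  proof -
    have test: "test s (linexp_code c h) (linexp_code c h') \<longleftrightarrow>
        linexp_val h (state_of c s) \<le> linexp_val h' (state_of c s)" for s
      unfolding test_def by (rule encodes_ennreal_le[OF encodes_linexp encodes_linexp, symmetric])
    show ?thesis
    proof
      assume ?test
      then show "h \<preceq> h'"
        unfolding linexp_le_iff_bounded[of h h' c] test S_def
        using ex_state_of_eq[OF assms] by metis
    qed (simp add: test linexp_le_def)
  qed
  with eval show ?thesis
    unfolding decidable2_def by (intro exI[of _ p] conjI allI) (auto simp: of_bool_def)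
qed

end
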